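(* Let $\mathcal{H}_1,\mathcal{H}_2,\mathcal{H}_3,\mathcal{H}_4$ be separable Hilbert spaces, $r\in\mathbb{N}$, $M\in L_2(\mathcal{H}_1,\mathcal{H}_4)$, $B\in\mathcal{B}(\mathcal{H}_3,\mathcal{H}_4)$, $C\in\mathcal{B}(\mathcal{H}_1,\mathcal{H}_2)$. Put $K:=P_{\overline{\operatorname{ran}B}}MP_{(\ker C)^\perp}$, suppose that the set $\mathcal{Y}_r$ defined in the context is nonempty, let $(K)_r\in\mathcal{Y}_r$ and $\hat X:=B^\dagger(K)_rC^\dagger:\operatorname{dom}(C^\dagger)\subset\mathcal{H}_2\to\mathcal{H}_3$. With $C_n^\#$ the finite-rank operators defined in the context, put $\hat X_n:=B^\dagger(K)_rC_n^\#$ (same $(K)_r$). Then $\hat X_n\in\mathcal{B}_{00,r}(\mathcal{H}_2,\mathcal{H}_3)$, $\hat X_n\to\hat X$ pointwise on $\operatorname{dom}(\hat X)$, and $B\hat X_nC\to B\hat XC$ in $L_2(\mathcal{H}_1,\mathcal{H}_4)$. Furthermore, $P_{(\ker B)^\perp}\hat X_nP_{\overline{\operatorname{ran}C}}=\hat X_n$ for all $n$. It follows that $$\inf\{\|M-BXC\|_{L_2}:\ X\in\mathcal{B}_{00,r}(\mathcal{H}_2,\mathcal{H}_3)\}=\min\{\|M-BXC\|_{L_2}:\ X\in\mathcal{X}_r\}.$$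
   Context: All Hilbert spaces are over a common field $\mathbb{R}$ or $\mathbb{C}$ and may be finite- or infinite-dimensional. A linear operator $T:\mathcal{H}\to\mathcal{K}$ is a linear map defined on a linear subspace $\operatorname{dom}(T)\subset\mathcal{H}$, possibly unbounded. $\mathcal{B}(\mathcal{H},\mathcal{K})$ denotes the bounded everywhere-defined operators, $L_2(\mathcal{H},\mathcal{K})$ the Hilbert--Schmidt operators with norm $\|\cdot\|_{L_2}$, and $\mathcal{B}_{00,r}(\mathcal{H},\mathcal{K})$ the bounded operators with range of dimension at most $r$. $P_V$ is the orthogonal projector onto a closed subspace $V$. Moore--Penrose inverse: for $T\in\mathcal{B}(\mathcal{H},\mathcal{K})$, $\operatorname{dom}(T^\dagger)=\operatorname{ran}T\oplus(\operatorname{ran}T)^\perp$ and $T^\dagger(h+k)=(T|_{(\ker T)^\perp})^{-1}h$ for $h\in\operatorname{ran}T$, $k\in(\operatorname{ran}T)^\perp$. $\mathcal{X}_r=\{X:\mathcal{H}_2\to\mathcal{H}_3 \text{ linear}:\ \operatorname{dom}(X)\supset\operatorname{dom}(C^\dagger),\ \dim\operatorname{ran}X\le r,\ BXC\in L_2(\mathcal{H}_1,\mathcal{H}_4)\}$, and $\mathcal{Y}_r=\{Y\in\mathcal{B}_{00,r}(\mathcal{H}_1,\mathcal{H}_4):\ \operatorname{ran}Y\subset\operatorname{dom}(B^\dagger),\ \|K-Y\|_{L_2}\le\|K-\tilde Y\|_{L_2}\ \forall\,\tilde Y\in\mathcal{B}_{00,r}(\mathcal{H}_1,\mathcal{H}_4)\}$;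 the latter consists of the rank-$r$ truncated SVDs $(K)_r$ of $K$ that map into $\operatorname{dom}(B^\dagger)$. Outer inverses: let $(Y_n)_n$ be an increasing sequence of finite-dimensional subspaces of $\overline{\operatorname{ran}C}$ with $\overline{\bigcup_nY_n}=\overline{\operatorname{ran}C}$. Put $X_n:=C^*Y_n$, let $P_n$ be the orthogonal projector onto $Y_n$, and $C_n:=P_nC$. Then $(\ker C_n)^\perp=X_n$, $\operatorname{ran}C_n=Y_n$, and $C_n|_{X_n}:X_n\to Y_n$ is invertible. $C_n^\#:\mathcal{H}_2\to\mathcal{H}_1$ is the finite-rank linear operator with $C_n^\#y=(C_n|_{X_n})^{-1}y$ for $y\in Y_n$ and $C_n^\#y=0$ for $y\in Y_n^\perp$. *)

theory Defs
  imports "HOL-Analysis.Analysis"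
begin

section \<open>The scalar field\<close>

text \<open>
  The instances of this class are exactly \<open>\<real>\<close> with the identity and \<open>\<complex>\<close> with complex conjugation,
  up to isomorphism: every \<open>x\<close> is a root of
  the real polynomial \<open>(t - x) (t - rc_conj x)\<close>, so the field is algebraic over the reals, and
  the third axiom determines \<open>rc_conj\<close>.
\<close>

class rc_field = real_normed_field +
  fixes rc_conj :: "'a \<Rightarrow> 'a"
  assumes rc_conj_add: "rc_conj (x + y) = rc_conj x + rc_conj y"
    and rc_conj_mult: "rc_conj (x * y) = rc_conj x * rc_conj y"
    and rc_conj_norm: "x * rc_conj x = scaleR ((norm x)\<^sup>2) 1"
    and rc_conj_sum_real: "\<exists>r. x + rc_conj x = scaleR r 1"

instantiation real :: rc_field
begin
definition rc_conj_real_def: "rc_conj (x::real) = x"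
instance
  by standard (auto simp: rc_conj_real_def power2_eq_square)
end

instantiation complex :: rc_field
begin
definition rc_conj_complex_def: "rc_conj (z::complex) = cnj z"
instance
proof
  fix x y :: complex
  show "rc_conj (x + y) = rc_conj x + rc_conj y" "rc_conj (x * y) = rc_conj x * rc_conj y"
    by (simp_all add: rc_conj_complex_def)
  show "x * rc_conj x = (norm x)\<^sup>2 *\<^sub>R 1"
    by (metis complex_norm_square rc_conj_complex_def of_real_def)
  show "\<exists>r. x + rc_conj x = r *\<^sub>R 1"
    by (metis complex_add_cnj rc_conj_complex_def of_real_def)
qed
end


section \<open>Hilbert spaces\<close>

text \<open>
  Vector addition, norm and topology come from the type; scalar multiplication and inner product
  over the field \<open>'k\<close> are carried by a record.  The last axiom of \<open>hilbert_space\<close> says that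
  the norm of the type is the one induced by the inner product (linear in the first argument).
  The real inner product of the type class is then the real part of \<open>ipr H\<close>.
\<close>

record ('k, 'a) hilb =
  scl :: "'k \<Rightarrow> 'a \<Rightarrow> 'a"
  ipr :: "'a \<Rightarrow> 'a \<Rightarrow> 'k"

locale hilbert_space =
  fixes H :: "('k::rc_field, 'a::{real_inner,complete_space}) hilb"
  assumes vector_space_scl: "vector_space (scl H)"
    and scl_of_real: "scl H (of_real a) x = a *\<^sub>R x"
    and ipr_add_left: "ipr H (x + y) z = ipr H x z + ipr H y z"
    and ipr_scl_left: "ipr H (scl H c x) y = c * ipr H x y"
    and ipr_commute: "ipr H y x = rc_conj (ipr H x y)"
    and ipr_self: "ipr H x x = of_real ((norm x)\<^sup>2)"

lemma hilbert_space_real: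
  "hilbert_space \<lparr>scl = scaleR, ipr = (inner :: 'a::{real_inner,complete_space} \<Rightarrow> 'a \<Rightarrow> real)\<rparr>"
proof
qed (auto simp: rc_conj_real_def inner_add_left scaleR_add_right scaleR_add_left
    intro: inner_commute power2_norm_eq_inner[symmetric])

lemma hilbert_space_complex:
  "hilbert_space \<lparr>scl = (*), ipr = (\<lambda>x y :: complex. x * cnj y)\<rparr>"
proof
qed (auto simp: rc_conj_complex_def distrib_left distrib_right scaleR_conv_of_real
    simp flip: complex_norm_square)

definition orth :: "('k::rc_field, 'a::{real_inner,complete_space}) hilb \<Rightarrow> 'a set \<Rightarrow> 'a set" where
  "orth H S = {x. \<forall>y\<in>S. ipr H x y = 0}"

definition proj :: "('k::rc_field, 'a::{real_inner,complete_space}) hilb \<Rightarrow> 'a set \<Rightarrow> 'a \<Rightarrow> 'a" where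
  "proj H V x = (THE v. v \<in> V \<and> x - v \<in> orth H V)"

text \<open>The library's \<open>dim\<close> is \<open>0\<close> on infinite-dimensional spaces, hence an explicit finite basis.\<close>

definition dim_at_most :: "('k::rc_field, 'a::{real_inner,complete_space}) hilb \<Rightarrow> 'a set \<Rightarrow> nat \<Rightarrow> bool" where
  "dim_at_most H V r \<longleftrightarrow> (\<exists>E. finite E \<and> \<not> module.dependent (scl H) E
     \<and> module.span (scl H) E = V \<and> card E \<le> r)"

definition fin_dim_subspace :: "('k::rc_field, 'a::{real_inner,complete_space}) hilb \<Rightarrow> 'a set \<Rightarrow> bool" where
  "fin_dim_subspace H V \<longleftrightarrow> module.subspace (scl H) V \<and> (\<exists>r. dim_at_most H V r)"


section \<open>Operators\<close>

definition ker :: "('a \<Rightarrow> 'b::zero) \<Rightarrow> 'a set" where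
  "ker T = {x. T x = 0}"

definition bounded_ops ::
  "('k::rc_field, 'a::{real_inner,complete_space}) hilb \<Rightarrow> ('k, 'b::{real_inner,complete_space}) hilb
     \<Rightarrow> ('a \<Rightarrow> 'b) set" where
  "bounded_ops H K = {T. Vector_Spaces.linear (scl H) (scl K) T \<and> bounded_linear T}"

definition bounded_rank_ops ::
  "('k::rc_field, 'a::{real_inner,complete_space}) hilb \<Rightarrow> ('k, 'b::{real_inner,complete_space}) hilb
     \<Rightarrow> nat \<Rightarrow> ('a \<Rightarrow> 'b) set" where
  "bounded_rank_ops H K r = {T \<in> bounded_ops H K. dim_at_most K (range T) r}"

text \<open>
  A linear operator with domain \<open>D\<close> is a pair \<open>(D, T)\<close>; the values of \<open>T\<close> outside \<open>D\<close> are irrelevant.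
\<close>

definition linear_ops ::
  "('k::rc_field, 'a::{real_inner,complete_space}) hilb \<Rightarrow> ('k, 'b::{real_inner,complete_space}) hilb
     \<Rightarrow> ('a set \<times> ('a \<Rightarrow> 'b)) set" where
  "linear_ops H K = {(D, T). module.subspace (scl H) D
     \<and> (\<forall>x\<in>D. \<forall>y\<in>D. T (x + y) = T x + T y)
     \<and> (\<forall>c. \<forall>x\<in>D. T (scl H c x) = scl K c (T x))}"

definition adj ::
  "('k::rc_field, 'a::{real_inner,complete_space}) hilb \<Rightarrow> ('k, 'b::{real_inner,complete_space}) hilb
     \<Rightarrow> ('a \<Rightarrow> 'b) \<Rightarrow> 'b \<Rightarrow> 'a" where
  "adj H K T = (SOME S. \<forall>x y. ipr K (T x) y = ipr H x (S y))"


section \<open>Hilbert--Schmidt operators\<close>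

definition is_onb :: "('k::rc_field, 'a::{real_inner,complete_space}) hilb \<Rightarrow> 'a set \<Rightarrow> bool" where
  "is_onb H E \<longleftrightarrow> (\<forall>e\<in>E. \<forall>f\<in>E. ipr H e f = (if e = f then 1 else 0))
     \<and> closure (module.span (scl H) E) = UNIV"

text \<open>
  Neither the class of Hilbert--Schmidt operators nor the norm depends on the choice of the
  orthonormal basis.  \<open>hs_norm\<close> has its meaning only on \<open>hs_ops\<close>, because \<open>infsum\<close> is \<open>0\<close> for
  families that are not summable.
\<close>

definition hs_ops ::
  "('k::rc_field, 'a::{real_inner,complete_space}) hilb \<Rightarrow> ('k, 'b::{real_inner,complete_space}) hilb
     \<Rightarrow> ('a \<Rightarrow> 'b) set" where
  "hs_ops H K = {T \<in> bounded_ops H K. \<exists>E. is_onb H E \<and> (\<lambda>e. (norm (T e))\<^sup>2) summable_on E}"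

definition hs_norm ::
  "('k::rc_field, 'a::{real_inner,complete_space}) hilb \<Rightarrow> ('a \<Rightarrow> 'b::{real_inner,complete_space}) \<Rightarrow> real" where
  "hs_norm H T = sqrt (\<Sum>\<^sub>\<infinity>e\<in>(SOME E. is_onb H E). (norm (T e))\<^sup>2)"


section \<open>Moore--Penrose inverse and outer inverses\<close>

definition pinv_dom :: "('k::rc_field, 'b::{real_inner,complete_space}) hilb \<Rightarrow> ('a \<Rightarrow> 'b) \<Rightarrow> 'b set" where
  "pinv_dom K T = {h + k | h k. h \<in> range T \<and> k \<in> orth K (range T)}"

text \<open>To be used on \<open>pinv_dom K T\<close> only; \<open>inv_into (orth H (ker T)) T\<close> inverts the restriction of \<open>T\<close>.\<close>

definition pinv ::
  "('k::rc_field, 'a::{real_inner,complete_space}) hilb \<Rightarrow> ('k, 'b::{real_inner,complete_space}) hilb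
     \<Rightarrow> ('a \<Rightarrow> 'b) \<Rightarrow> 'b \<Rightarrow> 'a" where
  "pinv H K T y = inv_into (orth H (ker T)) T (THE h. h \<in> range T \<and> y - h \<in> orth K (range T))"

text \<open>
  With \<open>V = Y\<^sub>n\<close> and \<open>T = C\<close> this is the outer inverse of \<open>P\<^sub>n C\<close>: on \<open>V\<close> the projector is
  the identity, and on the orthogonal complement of \<open>V\<close> the result is the preimage of \<open>0\<close>, that is \<open>0\<close>.
\<close>

definition outer_inv ::
  "('k::rc_field, 'a::{real_inner,complete_space}) hilb \<Rightarrow> ('k, 'b::{real_inner,complete_space}) hilb
     \<Rightarrow> ('a \<Rightarrow> 'b) \<Rightarrow> 'b set \<Rightarrow> 'b \<Rightarrow> 'a" where
  "outer_inv H K T V y = inv_into (adj H K T ` V) (proj K V \<circ> T) (proj K V y)"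


section \<open>The sets of candidates\<close>

definition X_set ::
  "('k::rc_field, 'a::{real_inner,complete_space}) hilb \<Rightarrow> ('k, 'b::{real_inner,complete_space}) hilb
     \<Rightarrow> ('k, 'c::{real_inner,complete_space}) hilb \<Rightarrow> ('k, 'd::{real_inner,complete_space}) hilb
     \<Rightarrow> ('c \<Rightarrow> 'd) \<Rightarrow> ('a \<Rightarrow> 'b) \<Rightarrow> nat \<Rightarrow> ('b set \<times> ('b \<Rightarrow> 'c)) set" where
  "X_set H1 H2 H3 H4 B C r = {(D, X) \<in> linear_ops H2 H3.
     pinv_dom H2 C \<subseteq> D \<and> dim_at_most H3 (X ` D) r \<and> B \<circ> X \<circ> C \<in> hs_ops H1 H4}"

definition Y_set ::
  "('k::rc_field, 'a::{real_inner,complete_space}) hilb \<Rightarrow> ('k, 'd::{real_inner,complete_space}) hilb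
     \<Rightarrow> ('c \<Rightarrow> 'd) \<Rightarrow> ('a \<Rightarrow> 'd) \<Rightarrow> nat \<Rightarrow> ('a \<Rightarrow> 'd) set" where
  "Y_set H1 H4 B K r = {Y \<in> bounded_rank_ops H1 H4 r. range Y \<subseteq> pinv_dom H4 B
     \<and> (\<forall>Y' \<in> bounded_rank_ops H1 H4 r. hs_norm H1 (\<lambda>x. K x - Y x) \<le> hs_norm H1 (\<lambda>x. K x - Y' x))}"

end

theory Submission
  imports Defs
begin

text \<open>
  Write \<open>P\<close>, \<open>Q\<close> for the projectors onto \<open>closure (range B)\<close> and \<open>(ker C)\<^sup>\<bottom>\<close>. By Pythagoras for the
  Hilbert--Schmidt norm, \<open>M - Z\<close> and \<open>K - Z\<close> have squared norms differing by a constant as soon as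
  \<open>P Z Q = Z\<close>; this applies to every \<open>Z = B X C\<close> and, by optimality, to \<open>Z = (K)\<^sub>r\<close>, so \<open>Xhat\<close>, for
  which \<open>B Xhat C = (K)\<^sub>r\<close>, is a minimiser. The outer inverse satisfies \<open>C\<^sub>n\<^sup># C = Q\<^sub>n\<close> with \<open>Q\<^sub>n\<close> the projector
  onto \<open>X\<^sub>n = C\<^sup>* Y\<^sub>n\<close>, and these projectors converge pointwise to \<open>Q\<close>. Since \<open>(K)\<^sub>r\<close> has finite rank,
  \<open>B\<^sup>\<dagger> (K)\<^sub>r\<close> is bounded, which gives pointwise convergence, and
  \<open>B Xhatn C - B Xhat C = (K)\<^sub>r (Q\<^sub>n - Q)\<close>, whose squared norm is a finite sum of
  \<open>\<parallel>(Q\<^sub>n - Q) (K)\<^sub>r\<^sup>* f\<parallel>\<^sup>2\<close> over an orthonormal basis of the range of \<open>(K)\<^sub>r\<close>.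
\<close>

section \<open>The scalar field and inner products\<close>

lemma rc_conj_zero [simp]: "rc_conj (0::'k::rc_field) = 0"
  using rc_conj_add[of "0::'k" 0] by simp

text \<open>The axiom \<open>rc_conj_norm\<close> makes \<open>a\<close> times its conjugate equal
  to \<open>a * a\<close>, and a nonzero \<open>a\<close> cancels.\<close>

lemma rc_conj_of_real [simp]: "rc_conj (of_real a :: 'k::rc_field) = of_real a"
proof (cases "a = 0")
  case False
  have "of_real a * rc_conj (of_real a :: 'k) = of_real a * of_real a"
    using rc_conj_norm[of "of_real a :: 'k"] by (simp add: of_real_def power2_eq_square)
  with False show ?thesis by simp
qed simp

text \<open>The sum \<open>x + rc_conj x\<close> is real, hence fixed by conjugation; cancelling
  \<open>rc_conj x\<close> from both expressions for it gives the claim.\<close>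

lemma rc_conj_conj [simp]: "rc_conj (rc_conj x) = (x::'k::rc_field)"
proof -
  obtain r where r: "x + rc_conj x = of_real r"
    using rc_conj_sum_real[of x] by (auto simp: of_real_def)
  then have "rc_conj x + rc_conj (rc_conj x) = of_real r"
    by (metis rc_conj_add rc_conj_of_real)
  with r show ?thesis by (metis add.commute add_left_cancel)
qed

lemma mult_rc_conj: "x * rc_conj x = of_real ((norm (x::'k::rc_field))\<^sup>2)"
  by (simp add: rc_conj_norm of_real_def)

lemma norm_rc_conj [simp]: "norm (rc_conj x) = norm (x::'k::rc_field)"
proof (cases "x = 0")
  case False
  have "norm x * norm (rc_conj x) = norm x * norm x"
    by (metis mult_rc_conj norm_mult norm_of_real abs_norm_cancel power2_eq_square)
  with False show ?thesis by simp
qed simp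

lemma rc_conj_eq_0 [simp]: "rc_conj x = 0 \<longleftrightarrow> x = (0::'k::rc_field)"
  by (metis norm_rc_conj norm_eq_zero)

section \<open>Sums of nonnegative families\<close>

text \<open>Tonelli for a double family whose row and column sums are known. It is what makes the
  Hilbert-Schmidt norm independent of the basis.\<close>

lemma nonneg_has_sum_swap:
  fixes g :: "'x \<Rightarrow> 'y \<Rightarrow> real"
  assumes rows: "\<And>e. e \<in> E \<Longrightarrow> ((\<lambda>f. g e f) has_sum a e) F"
    and cols: "\<And>f. f \<in> F \<Longrightarrow> ((\<lambda>e. g e f) has_sum b f) E"
    and nonneg: "\<And>e f. g e f \<ge> 0" and sum: "(a has_sum s) E"
  shows "(b has_sum s) F"
proof -
  have "(\<lambda>(e, f). g e f) summable_on (E \<times> F)"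
    by (rule summable_on_SigmaI[where g = a])
      (use rows sum nonneg in \<open>auto simp: summable_on_def\<close>)
  then have "((\<lambda>(e, f). g e f) has_sum s) (E \<times> F)"
    by (intro has_sum_SigmaI[where g = a]) (use rows sum in auto)
  then have "((\<lambda>(f, e). g e f) has_sum s) (F \<times> E)"
    using has_sum_swap[where f = "\<lambda>(e, f). g e f" and S = s and A = E and B = F] by (simp add: case_prod_unfold)
  then show ?thesis
    by (rule has_sum_SigmaD) (use cols in auto)
qed

text \<open>Both summands are dominated by \<open>f\<close>, hence summable. This serves to sum
  Pythagoras over an orthonormal basis.\<close>

lemma has_sum_split:
  fixes f g h :: "'i \<Rightarrow> real"
  assumes "(f has_sum s) E" "\<And>e. f e = g e + h e" "\<And>e. g e \<ge> 0" "\<And>e. h e \<ge> 0"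
  obtains t u where "(g has_sum t) E" "(h has_sum u) E" "s = t + u"
proof -
  have f: "f summable_on E" using assms(1) by (auto simp: summable_on_def)
  have "g summable_on E" "h summable_on E"
    by (rule summable_on_comparison_test[OF f]; simp add: assms)+
  then obtain t u where tu: "(g has_sum t) E" "(h has_sum u) E" unfolding summable_on_def by blast
  from has_sum_add[OF this] have "(f has_sum (t + u)) E" using assms(2) by presburger
  with assms(1) have "s = t + u" using has_sum_unique by blast
  with tu that show ?thesis by blast
qed

section \<open>Inner product, orthogonality and closures in one Hilbert space\<close>

context hilbert_space
begin

sublocale vs: vector_space "scl H"
  by (rule vector_space_scl)

abbreviation ip where "ip \<equiv> ipr H"
abbreviation sc where "sc \<equiv> scl H"
abbreviation sub where "sub \<equiv> module.subspace (scl H)"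

lemma ip_zero_left [simp]: "ip 0 y = 0"
  using ipr_add_left[of 0 0 y] by simp

lemma ip_minus_left [simp]: "ip (- x) y = - ip x y"
  using ipr_add_left[of x "- x" y] by (simp add: eq_neg_iff_add_eq_0 add.commute)

lemma ip_diff_left: "ip (x - y) z = ip x z - ip y z"
  using ipr_add_left[of x "- y" z] by simp

lemma ip_add_right: "ip x (y + z) = ip x y + ip x z"
  by (metis ipr_add_left ipr_commute rc_conj_add)

lemma ip_zero_right [simp]: "ip y 0 = 0"
  using ip_add_right[of y 0 0] by simp

lemma ip_minus_right [simp]: "ip x (- y) = - ip x y"
  using ip_add_right[of x y "- y"] by (simp add: eq_neg_iff_add_eq_0 add.commute)

lemma ip_diff_right: "ip x (y - z) = ip x y - ip x z"
  using ip_add_right[of x y "- z"] by simp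

lemma ip_sc_right: "ip x (sc c y) = rc_conj c * ip x y"
  by (metis ipr_scl_left ipr_commute rc_conj_mult)

lemma ip_sum_left: "ip (sum f A) y = (\<Sum>a\<in>A. ip (f a) y)"
  by (induction A rule: infinite_finite_induct) (auto simp: ipr_add_left)

lemma ip_sum_right: "ip y (sum f A) = (\<Sum>a\<in>A. ip y (f a))"
  by (induction A rule: infinite_finite_induct) (auto simp: ip_add_right)

lemma ip_self_eq_0 [simp]: "ip x x = 0 \<longleftrightarrow> x = 0"
  by (simp add: ipr_self)

lemma ip_eq_0_sym: "ip x y = 0 \<longleftrightarrow> ip y x = 0"
  by (metis ipr_commute rc_conj_zero)

lemma sc_real: "sc (of_real a) x = a *\<^sub>R x"
  by (rule scl_of_real)

text \<open>Comparing the expansions of the squared norm of \<open>x + y\<close> through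
  \<open>ip\<close> and through \<open>inner\<close> identifies \<open>inner\<close> as the real
  part of \<open>ip\<close>.\<close>

lemma ip_plus_conj: "ip x y + ip y x = of_real (2 * inner x y)"
proof -
  have "ip (x + y) (x + y) = of_real ((norm (x + y))\<^sup>2)" by (rule ipr_self)
  moreover have "(norm (x + y))\<^sup>2 = (norm x)\<^sup>2 + (norm y)\<^sup>2 + 2 * inner x y"
    by (simp add: power2_norm_eq_inner inner_add_left inner_add_right inner_commute)
  ultimately have "ip x x + ip y y + (ip x y + ip y x)
     = of_real ((norm x)\<^sup>2) + of_real ((norm y)\<^sup>2) + of_real (2 * inner x y)"
    by (simp add: ipr_add_left ip_add_right algebra_simps)
  then show ?thesis by (simp only: ipr_self) simp
qed

lemma inner_eq_0_if_ip: "ip x y = 0 \<Longrightarrow> inner x y = 0"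
proof -
  assume a: "ip x y = 0"
  then have "of_real (2 * inner x y) = (0::'k)" using ip_plus_conj[of x y] ip_eq_0_sym[of x y] by (simp only: simp_thms add_0) 
  then show ?thesis unfolding of_real_eq_0_iff by simp
qed

text \<open>Multiplying \<open>y\<close> by the scalar \<open>ip x y\<close> makes the inner product
  with \<open>x\<close> a nonnegative real, so that facts about \<open>inner\<close> transfer to
  \<open>ip\<close>.\<close>

lemma inner_sc_ip: "inner x (sc (ip x y) y) = (norm (ip x y))\<^sup>2"
proof -
  have "ip x (sc (ip x y) y) = of_real ((norm (ip x y))\<^sup>2)"
    using mult_rc_conj[of "ip x y"] by (simp add: ip_sc_right mult.commute)
  then have "ip x (sc (ip x y) y) + ip (sc (ip x y) y) x = of_real (2 * (norm (ip x y))\<^sup>2)"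
    by (metis ipr_commute rc_conj_of_real mult_2 of_real_add)
  then have "of_real (2 * inner x (sc (ip x y) y)) = (of_real (2 * (norm (ip x y))\<^sup>2) :: 'k)"
    using ip_plus_conj[of x "sc (ip x y) y"] by metis
  then show ?thesis unfolding of_real_eq_iff by simp
qed

lemma norm_sc: "norm (sc c x) = norm c * norm x"
proof -
  have "of_real ((norm (sc c x))\<^sup>2) = (of_real ((norm c)\<^sup>2 * (norm x)\<^sup>2) :: 'k)"
    unfolding ipr_self[symmetric] of_real_mult mult_rc_conj[symmetric]
    by (simp add: ipr_scl_left ip_sc_right)
  then have "(norm (sc c x))\<^sup>2 = (norm c * norm x)\<^sup>2" 
    by (simp only: of_real_eq_iff power_mult_distrib)
  then show ?thesis by (simp add: power2_eq_iff_nonneg)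
qed

text \<open>Real Cauchy-Schwarz for \<open>x\<close> and \<open>sc (ip x y) y\<close> carries a
  surplus factor \<open>norm (ip x y)\<close> on both sides, which cancels.\<close>

lemma norm_ip_le: "norm (ip x y) \<le> norm x * norm y"
proof (cases "ip x y = 0")
  case False
  have "(norm (ip x y))\<^sup>2 \<le> norm x * (norm (ip x y) * norm y)"
    using norm_cauchy_schwarz[of x "sc (ip x y) y"] by (simp add: inner_sc_ip norm_sc)
  with False show ?thesis by (simp add: power2_eq_square ac_simps)
qed simp

lemma ip_eqI_right: "(\<And>z. ip z x = ip z y) \<Longrightarrow> x = y"
  using ip_self_eq_0[of "x - y"] by (simp add: ip_diff_right)

lemma bounded_linear_ip: "bounded_linear (\<lambda>x. ip x y)"
proof (rule bounded_linear_intro[of _ "norm y"])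
  fix r x show "ip (r *\<^sub>R x) y = r *\<^sub>R ip x y"
    by (simp add: sc_real[symmetric] ipr_scl_left scaleR_conv_of_real)
qed (auto simp: ipr_add_left norm_ip_le)

lemma bounded_linear_ip_right: "bounded_linear (\<lambda>y. ip x y)"
proof (rule bounded_linear_intro[of _ "norm x"])
  fix r y show "ip x (r *\<^sub>R y) = r *\<^sub>R ip x y"
    by (simp add: sc_real[symmetric] ip_sc_right scaleR_conv_of_real)
  show "norm (ip x y) \<le> norm y * norm x" by (metis norm_ip_le mult.commute)
qed (auto simp: ip_add_right)

lemma bounded_linear_sc: "bounded_linear (\<lambda>x. sc c x)"
proof (rule bounded_linear_intro[of _ "norm c"])
  fix r x show "sc c (r *\<^sub>R x) = r *\<^sub>R sc c x"
    by (simp add: sc_real[symmetric] mult.commute)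
qed (auto simp: vs.scale_right_distrib norm_sc)

lemma orthD: "x \<in> orth H V \<Longrightarrow> y \<in> V \<Longrightarrow> ip x y = 0"
  by (auto simp: orth_def)

lemma orthD': "x \<in> orth H V \<Longrightarrow> y \<in> V \<Longrightarrow> ip y x = 0"
  by (auto simp: orth_def ip_eq_0_sym)

lemma subspace_orth: "sub (orth H V)"
  by (auto simp: vs.subspace_def orth_def ipr_add_left ipr_scl_left)

lemma closed_orth: "closed (orth H V)"
proof -
  have "orth H V = (\<Inter>y\<in>V. {x. ip x y = 0})" by (auto simp: orth_def)
  moreover have "closed {x. ip x y = 0}" for y
    by (intro closed_Collect_eq continuous_on_const linear_continuous_on bounded_linear_ip)
  ultimately show ?thesis by auto
qed

text \<open>For fixed \<open>x\<close> the vectors \<open>y\<close> with \<open>ip x y = 0\<close>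
  form a closed set, so orthogonality passes to limits.\<close>

lemma orth_closure: "orth H (closure V) = orth H V"
proof
  show "orth H V \<subseteq> orth H (closure V)"
  proof
    fix x assume x: "x \<in> orth H V"
    have "closed {y. ip x y = 0}"
      by (intro closed_Collect_eq continuous_on_const linear_continuous_on bounded_linear_ip_right)
    moreover have "V \<subseteq> {y. ip x y = 0}" using x by (auto simp: orth_def)
    ultimately have "closure V \<subseteq> {y. ip x y = 0}" by (simp add: closure_minimal)
    then show "x \<in> orth H (closure V)" by (auto simp: orth_def)
  qed
qed (use closure_subset in \<open>auto simp: orth_def\<close>)

lemma orth_Int: "x \<in> V \<Longrightarrow> x \<in> orth H V \<Longrightarrow> x = 0"
  using orthD[of x V x] by simp

lemma subspace_scaleR: "sub V \<Longrightarrow> x \<in> V \<Longrightarrow> a *\<^sub>R x \<in> V"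
  using vs.subspace_scale[of V x "of_real a"] by (simp add: sc_real)

lemma subspace_closure: "sub V \<Longrightarrow> sub (closure V)"
proof (rule vs.subspaceI)
  assume V: "sub V"
  show "0 \<in> closure V" using vs.subspace_0[OF V] closure_subset by blast
  fix x assume x: "x \<in> closure V"
  then obtain f where f: "\<And>n. f n \<in> V" "f \<longlonglongrightarrow> x" by (auto simp: closure_sequential)
  { fix y assume "y \<in> closure V"
    then obtain g where g: "\<And>n. g n \<in> V" "g \<longlonglongrightarrow> y" by (auto simp: closure_sequential)
    have "(\<lambda>n. f n + g n) \<longlonglongrightarrow> x + y" using f g by (intro tendsto_add)
    then show "x + y \<in> closure V"
      using f g vs.subspace_add[OF V] unfolding closure_sequential
      by (intro exI[of _ "\<lambda>n. f n + g n"]) auto }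
  fix c
  have "(\<lambda>n. sc c (f n)) \<longlonglongrightarrow> sc c x"
    using f by (intro bounded_linear.tendsto[OF bounded_linear_sc])
  then show "sc c x \<in> closure V"
    using f vs.subspace_scale[OF V] unfolding closure_sequential
    by (intro exI[of _ "\<lambda>n. sc c (f n)"]) auto
qed

text \<open>For a subspace, a real-orthogonal vector is orthogonal over the field: scale by the inner product.\<close>

lemma orthI_inner:
  assumes "sub V" "\<And>v. v \<in> V \<Longrightarrow> inner x v = 0"
  shows "x \<in> orth H V"
proof -
  have "ip x y = 0" if "y \<in> V" for y
    using assms(2)[OF vs.subspace_scale[OF assms(1) that, of "ip x y"]] by (simp add: inner_sc_ip)
  then show ?thesis by (simp add: orth_def)
qed

lemma norm_add_orth: "ip x y = 0 \<Longrightarrow> (norm (x + y))\<^sup>2 = (norm x)\<^sup>2 + (norm y)\<^sup>2"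
  using inner_eq_0_if_ip[of x y]
  by (simp add: power2_norm_eq_inner inner_add_left inner_add_right inner_commute)

section \<open>Orthogonal projection\<close>

text \<open>A minimising sequence for the distance from \<open>x\<close> to \<open>V\<close> is
  Cauchy, and a variation of its limit along a line in \<open>V\<close> shows that the residual is
  orthogonal.\<close>

lemma proj_existence:
  assumes V: "sub V" and cl: "closed V"
  shows "\<exists>v\<in>V. x - v \<in> orth H V"
proof -
  define S where "S = (\<lambda>v. (norm (x - v))\<^sup>2) ` V"
  define d where "d = Inf S"
  have ne: "V \<noteq> {}" using vs.subspace_0[OF V] by auto
  have bdd: "bdd_below S" unfolding S_def by (rule bdd_belowI[of _ 0]) auto
  have d_le: "d \<le> (norm (x - v))\<^sup>2" if "v \<in> V" for v
    unfolding d_def S_def by (rule cInf_lower) (use that bdd in \<open>auto simp: S_def\<close>)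
  have ex: "\<exists>v\<in>V. (norm (x - v))\<^sup>2 < d + e" if "e > 0" for e
  proof -
    have "Inf S < d + e" using that by (simp add: d_def)
    then show ?thesis using ne cInf_lessD[of S "d + e"] by (auto simp: S_def)
  qed
  have "\<exists>v. v \<in> V \<and> (norm (x - v))\<^sup>2 < d + inverse (real (Suc n))" for n
    using ex[of "inverse (real (Suc n))"] by auto
  then obtain f where f: "\<And>n. f n \<in> V" "\<And>n. (norm (x - f n))\<^sup>2 < d + inverse (real (Suc n))"
    by metis
  have par: "(norm (f m - f n))\<^sup>2 \<le> 2 * inverse (real (Suc m)) + 2 * inverse (real (Suc n))" for m n
  proof -
    \<comment> \<open>Parallelogram law: the midpoint of two near-minimisers lies in
      \<open>V\<close>, so its squared distance from \<open>x\<close> is at least \<open>d\<close>,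
      which forces the two to be close.\<close>
    have "(1/2) *\<^sub>R (f m + f n) \<in> V" using f V by (intro subspace_scaleR vs.subspace_add)
    then have "4 * d \<le> 4 * (norm (x - (1/2) *\<^sub>R (f m + f n)))\<^sup>2" using d_le by simp
    also have "\<dots> = 2 * (norm (x - f m))\<^sup>2 + 2 * (norm (x - f n))\<^sup>2 - (norm (f m - f n))\<^sup>2"
      by (simp add: power2_norm_eq_inner inner_diff_left inner_diff_right inner_add_left
          inner_add_right inner_commute algebra_simps)
    finally show ?thesis using f(2)[of m] f(2)[of n] by linarith
  qed
  have "Cauchy f"
  proof (rule metric_CauchyI)
    fix e :: real assume e: "e > 0"
    obtain N where N: "inverse (real (Suc N)) < e\<^sup>2 / 4"
      using reals_Archimedean[of "e\<^sup>2/4"] e by auto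
    have "dist (f m) (f n) < e" if "m \<ge> N" "n \<ge> N" for m n
    proof -
      have "inverse (real (Suc m)) \<le> inverse (real (Suc N))" "inverse (real (Suc n)) \<le> inverse (real (Suc N))"
        using that by (auto intro!: le_imp_inverse_le)
      with par[of m n] N have "(norm (f m - f n))\<^sup>2 < e\<^sup>2" by linarith
      then show ?thesis using e by (simp add: dist_norm power2_less_imp_less)
    qed
    then show "\<exists>M. \<forall>m\<ge>M. \<forall>n\<ge>M. dist (f m) (f n) < e" by blast
  qed
  then obtain v where v: "f \<longlonglongrightarrow> v" using Cauchy_convergent convergent_def by blast
  have vV: "v \<in> V" using cl f(1) v closed_sequentially by blast
  have "(\<lambda>n. (norm (x - f n))\<^sup>2) \<longlonglongrightarrow> (norm (x - v))\<^sup>2" by (intro tendsto_intros v)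
  moreover have "(\<lambda>n. d + inverse (real (Suc n))) \<longlonglongrightarrow> d + 0"
    by (intro tendsto_intros LIMSEQ_inverse_real_of_nat)
  ultimately have le: "(norm (x - v))\<^sup>2 \<le> d"
    using f(2) by (metis (no_types, lifting) LIMSEQ_le add.right_neutral less_imp_le)
  have "inner (x - v) w = 0" if w: "w \<in> V" for w
  proof (rule ccontr)
    assume ne0: "inner (x - v) w \<noteq> 0"
    then have w0: "inner w w > 0" by auto
    have expand: "(norm (a - t *\<^sub>R w))\<^sup>2 = (norm a)\<^sup>2 - 2 * t * inner a w + t * t * inner w w" for a t
      unfolding power2_norm_eq_inner by (simp add: inner_diff inner_commute[of w a] algebra_simps)
    \<comment> \<open>This \<open>t\<close> minimises the quadratic in \<open>expand\<close>; the
      strict gain contradicts the minimality of \<open>v\<close>.\<close>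
    define t where "t = inner (x - v) w / inner w w"
    have "v + t *\<^sub>R w \<in> V" using vV w V by (intro vs.subspace_add subspace_scaleR)
    then have "(norm (x - v))\<^sup>2 \<le> (norm (x - (v + t *\<^sub>R w)))\<^sup>2" using le d_le order_trans by blast
    also have "\<dots> = (norm ((x - v) - t *\<^sub>R w))\<^sup>2" by (simp add: algebra_simps)
    also have "\<dots> = (norm (x - v))\<^sup>2 - 2 * t * inner (x - v) w + t * t * inner w w"
      by (rule expand)
    also have "\<dots> = (norm (x - v))\<^sup>2 - (inner (x - v) w)\<^sup>2 / inner w w"
      using w0 by (simp add: t_def field_simps power2_eq_square)
    finally show False using w0 ne0 by (simp add: divide_le_0_iff)
  qed
  then show ?thesis using orthI_inner[OF V] vV by blast
qed

text \<open>Two candidates differ by a vector that lies in \<open>V\<close> and is orthogonal to it.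
  Projections are computed below by exhibiting a vector with these two properties.\<close>

lemma proj_unique:
  assumes V: "sub V" and "v \<in> V" "x - v \<in> orth H V"
  shows "proj H V x = v"
  unfolding proj_def
proof (rule the_equality)
  fix w assume w: "w \<in> V \<and> x - w \<in> orth H V"
  have "w - v \<in> V" using w assms vs.subspace_diff by blast
  moreover have "(x - v) - (x - w) \<in> orth H V" using w assms subspace_orth vs.subspace_diff by blast
  ultimately show "w = v" using orth_Int[of "w - v" V] by simp
qed (use assms in auto)

end

lemma linear_iff_scl:
  "hilbert_space H \<Longrightarrow> hilbert_space K \<Longrightarrow> Vector_Spaces.linear (scl H) (scl K) T \<longleftrightarrow>
    (\<forall>x y. T (x + y) = T x + T y) \<and> (\<forall>c x. T (scl H c x) = scl K c (T x))"
  unfolding module_hom_iff_linear[symmetric] module_hom_iff module_iff_vector_space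
  by (simp add: hilbert_space.vector_space_scl)

context hilbert_space
begin

lemma proj_in: "sub V \<Longrightarrow> closed V \<Longrightarrow> proj H V x \<in> V"
  using proj_existence[of V x] proj_unique[of V _ x] by metis

lemma proj_orth: "sub V \<Longrightarrow> closed V \<Longrightarrow> x - proj H V x \<in> orth H V"
  using proj_existence[of V x] proj_unique[of V _ x] by metis

lemma zero_orth [simp]: "0 \<in> orth H V"
  by (simp add: orth_def)

lemma proj_id: "sub V \<Longrightarrow> x \<in> V \<Longrightarrow> proj H V x = x"
  by (rule proj_unique) auto

lemma proj_eq_0: "sub V \<Longrightarrow> x \<in> orth H V \<Longrightarrow> proj H V x = 0"
  by (rule proj_unique) (auto simp: vs.subspace_0)

lemma proj_orth_complement:
  assumes "sub V" "closed V"
  shows "proj H (orth H V) x = x - proj H V x"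
  by (rule proj_unique[OF subspace_orth proj_orth[OF assms]])
    (use proj_in[OF assms] in \<open>auto simp: orth_def ip_eq_0_sym\<close>)

lemma orth_orth_subset: "V \<subseteq> orth H (orth H V)"
  by (auto simp: orth_def ip_eq_0_sym)

lemma proj_add:
  assumes "sub V" "closed V"
  shows "proj H V (x + y) = proj H V x + proj H V y"
proof (rule proj_unique[OF assms(1)])
  have "(x - proj H V x) + (y - proj H V y) \<in> orth H V"
    by (intro vs.subspace_add subspace_orth proj_orth assms)
  then show "x + y - (proj H V x + proj H V y) \<in> orth H V" by (simp add: algebra_simps)
qed (intro vs.subspace_add proj_in assms)

lemma proj_sc:
  assumes "sub V" "closed V"
  shows "proj H V (sc c x) = sc c (proj H V x)"
proof (rule proj_unique[OF assms(1)])
  have "sc c (x - proj H V x) \<in> orth H V"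
    by (intro vs.subspace_scale subspace_orth proj_orth assms)
  then show "sc c x - sc c (proj H V x) \<in> orth H V" by (simp add: vs.scale_right_diff_distrib)
qed (intro vs.subspace_scale proj_in assms)

lemma proj_pythagoras:
  assumes "sub V" "closed V"
  shows "(norm x)\<^sup>2 = (norm (proj H V x))\<^sup>2 + (norm (x - proj H V x))\<^sup>2"
  using norm_add_orth[of "proj H V x" "x - proj H V x"]
    orthD'[OF proj_orth[OF assms] proj_in[OF assms]] by simp

lemma norm_proj_le: "sub V \<Longrightarrow> closed V \<Longrightarrow> norm (proj H V x) \<le> norm x"
  by (rule power2_le_imp_le) (simp_all add: proj_pythagoras[of V x])

text \<open>\<open>x - v\<close> is the orthogonal sum of \<open>x - proj H V x\<close> and
  \<open>proj H V x - v\<close>, so Pythagoras applies.\<close>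

lemma norm_diff_proj_le:
  assumes "sub V" "closed V" "v \<in> V"
  shows "norm (x - proj H V x) \<le> norm (x - v)"
proof -
  have "ip (x - proj H V x) (proj H V x - v) = 0"
    using proj_in[OF assms(1,2)] assms vs.subspace_diff by (intro orthD[OF proj_orth]) auto
  from norm_add_orth[OF this] show ?thesis by (simp add: power2_le_imp_le)
qed

lemma ip_proj:
  assumes "sub V" "closed V"
  shows "ip (proj H V x) y = ip x (proj H V y)"
proof -
  have "ip (proj H V x) (y - proj H V y) = 0" "ip (x - proj H V x) (proj H V y) = 0"
    using orthD'[OF proj_orth[OF assms] proj_in[OF assms]] orthD[OF proj_orth[OF assms] proj_in[OF assms]] by auto
  then show ?thesis by (simp add: ip_diff_left ip_diff_right)
qed

section \<open>Bounded operators and the Riesz representation\<close>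

lemma bounded_opsI:
  assumes "hilbert_space K" "\<And>x y. T (x + y) = T x + T y" "\<And>c x. T (sc c x) = scl K c (T x)"
    and "\<And>x. norm (T x) \<le> norm x * b"
  shows "T \<in> bounded_ops H K"
proof -
  have "bounded_linear T"
    by (rule bounded_linear_intro[of _ b])
      (use assms(2-4) in \<open>auto simp: sc_real[symmetric] hilbert_space.scl_of_real[OF assms(1), symmetric]\<close>)
  then show ?thesis
    using assms linear_iff_scl[OF hilbert_space_axioms assms(1)] by (auto simp: bounded_ops_def)
qed

lemma proj_bounded: "sub V \<Longrightarrow> closed V \<Longrightarrow> proj H V \<in> bounded_ops H H"
  by (rule bounded_opsI[of _ _ 1]) (auto simp: hilbert_space_axioms proj_add proj_sc norm_proj_le)

text \<open>Unless \<open>f\<close> is zero, take a nonzero \<open>u\<close> orthogonal to its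
  closed kernel; subtracting \<open>f x / f u\<close> times \<open>u\<close> from \<open>x\<close>
  lands in the kernel, so \<open>u\<close> determines \<open>f\<close>.\<close>

lemma riesz_representation:
  assumes add: "\<And>x y. f (x + y) = f x + f y" and scale: "\<And>c x. f (sc c x) = c * f x"
    and bl: "bounded_linear f"
  shows "\<exists>z. \<forall>x. f x = ip x z"
proof (cases "\<forall>x. f x = 0")
  case True
  then show ?thesis by (intro exI[of _ 0]) simp
next
  case False
  then obtain x0 where x0: "f x0 \<noteq> 0" by auto
  define V where "V = {x. f x = 0}"
  have f0: "f 0 = 0" using bl linear_0 bounded_linear.linear by blast
  have V: "sub V" "closed V"
    unfolding V_def using f0 linear_continuous_on[OF bl]
    by (auto simp: vs.subspace_def add scale intro!: closed_Collect_eq)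
  define u where "u = x0 - proj H V x0"
  have u: "u \<in> orth H V" unfolding u_def by (rule proj_orth[OF V])
  have fdiff: "f (x - y) = f x - f y" for x y using bl by (simp add: linear_diff bounded_linear.linear)
  have fu: "f u \<noteq> 0" using x0 proj_in[OF V, of x0] by (simp add: u_def fdiff V_def)
  then have u0: "ip u u \<noteq> 0" using f0 by auto
  \<comment> \<open>The conjugate compensates for the antilinearity of \<open>ip\<close> in its
    second argument.\<close>
  have "f x = ip x (sc (rc_conj (f u / ip u u)) u)" for x
  proof -
    have "x - sc (f x / f u) u \<in> V" using fu by (simp add: V_def fdiff scale)
    then have "ip (x - sc (f x / f u) u) u = 0" using u orthD' by blast
    then have "ip x u = f x / f u * ip u u" by (simp add: ip_diff_left ipr_scl_left)
    then show ?thesis using fu u0 by (simp add: ip_sc_right)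
  qed
  then show ?thesis by blast
qed

section \<open>Orthonormal systems\<close>

abbreviation orthonormal where
  "orthonormal E \<equiv> \<forall>e\<in>E. \<forall>f\<in>E. ipr H e f = (if e = f then 1 else 0)"

lemma orth_span: "orth H (vs.span S) = orth H S"
proof
  show "orth H S \<subseteq> orth H (vs.span S)"
  proof
    fix x assume x: "x \<in> orth H S"
    have "ip x y = 0" if "y \<in> vs.span S" for y
      using that by (induction rule: vs.span_induct_alt) (use x in \<open>auto simp: orth_def ip_add_right ip_sc_right\<close>)
    then show "x \<in> orth H (vs.span S)" by (auto simp: orth_def)
  qed
qed (use vs.span_superset in \<open>auto simp: orth_def\<close>)

text \<open>By \<open>orth_span\<close> it is enough to test against members of \<open>F\<close>,
  where the sum collapses to one term.\<close>

lemma diff_expansion_orth: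
  assumes "finite F" "orthonormal F"
  shows "x - (\<Sum>e\<in>F. sc (ip x e) e) \<in> orth H (vs.span F)"
  unfolding orth_span
proof -
  have "ip (\<Sum>e\<in>F. sc (ip x e) e) f = ip x f" if "f \<in> F" for f
  proof -
    have "ip (\<Sum>e\<in>F. sc (ip x e) e) f = (\<Sum>e\<in>F. if e = f then ip x e else 0)"
      unfolding ip_sum_left ipr_scl_left by (rule sum.cong) (use assms that in auto)
    then show ?thesis using that assms by simp
  qed
  then show "x - (\<Sum>e\<in>F. sc (ip x e) e) \<in> orth H F" by (auto simp: orth_def ip_diff_left)
qed

lemma expansion_in_span: "(\<Sum>e\<in>F. sc (c e) e) \<in> vs.span F"
  by (intro vs.span_sum vs.span_scale vs.span_base)

lemma proj_span:
  assumes "finite F" "orthonormal F"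
  shows "proj H (vs.span F) x = (\<Sum>e\<in>F. sc (ip x e) e)"
  by (rule proj_unique) (use expansion_in_span diff_expansion_orth[OF assms] in auto)

text \<open>A limit point minus its expansion lies in the closure of the span and is orthogonal to
  it, hence vanishes.\<close>

lemma closed_span_orthonormal:
  assumes "finite F" "orthonormal F"
  shows "closed (vs.span F)"
proof -
  have "x \<in> vs.span F" if x: "x \<in> closure (vs.span F)" for x
  proof -
    let ?y = "\<Sum>e\<in>F. sc (ip x e) e"
    have "x - ?y \<in> closure (vs.span F)"
      using x expansion_in_span closure_subset
      by (intro vs.subspace_diff subspace_closure) auto
    moreover have "x - ?y \<in> orth H (closure (vs.span F))"
      using diff_expansion_orth[OF assms] orth_closure by simp
    ultimately have "x - ?y = 0" by (rule orth_Int)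
    then show ?thesis using expansion_in_span[of "ip x" F] by simp
  qed
  then show ?thesis using closure_subset_eq by blast
qed

lemma norm_1_if_ip: "ip a a = 1 \<Longrightarrow> norm a = 1"
proof -
  assume "ip a a = 1"
  then have "of_real ((norm a)\<^sup>2) = (1::'k)" by (simp only: ipr_self)
  then have "(norm a)\<^sup>2 = 1" by (simp only: of_real_eq_1_iff)
  then show "norm a = 1" using norm_ge_zero[of a] unfolding power2_eq_1_iff by linarith
qed

lemma norm_sum_orthonormal:
  assumes "finite F" "orthonormal F"
  shows "(norm (\<Sum>e\<in>F. sc (c e) e))\<^sup>2 = (\<Sum>e\<in>F. (norm (c e))\<^sup>2)"
  using assms
proof (induction F)
  case (insert a F)
  have "ip (sc (c a) a) (\<Sum>e\<in>F. sc (c e) e) = 0"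
    using insert.prems insert.hyps unfolding ip_sum_right ip_sc_right ipr_scl_left
    by (intro sum.neutral) auto
  moreover have "norm a = 1"
    using insert.prems by (intro norm_1_if_ip) auto
  ultimately have "(norm (\<Sum>e\<in>insert a F. sc (c e) e))\<^sup>2 = (norm (c a))\<^sup>2 + (norm (\<Sum>e\<in>F. sc (c e) e))\<^sup>2"
    using insert.hyps norm_add_orth by (simp add: norm_sc)
  moreover have "(norm (\<Sum>e\<in>F. sc (c e) e))\<^sup>2 = (\<Sum>e\<in>F. (norm (c e))\<^sup>2)"
    by (rule insert.IH) (use insert.prems in blast)
  ultimately show ?case
    using insert.hyps by simp
qed simp

lemma bessel_identity:
  assumes "finite F" "orthonormal F"
  shows "(norm x)\<^sup>2 = (\<Sum>e\<in>F. (norm (ip x e))\<^sup>2) + (norm (x - (\<Sum>e\<in>F. sc (ip x e) e)))\<^sup>2"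
  using proj_pythagoras[OF _ closed_span_orthonormal[OF assms], of x]
  by (simp add: proj_span[OF assms] norm_sum_orthonormal[OF assms])

lemma orthonormal_insert:
  assumes "orthonormal F" "u \<in> orth H F" "u \<noteq> 0"
  shows "orthonormal (insert (sc (of_real (inverse (norm u))) u) F)"
proof -
  let ?e = "sc (of_real (inverse (norm u))) u"
  have "norm ?e = 1" using assms(3) by (simp add: norm_sc norm_inverse)
  then have "ip ?e ?e = 1" by (simp add: ipr_self)
  moreover have "ip ?e f = 0" "ip f ?e = 0" if "f \<in> F" for f
    using orthD[OF assms(2) that] orthD'[OF assms(2) that] by (auto simp: ipr_scl_left ip_sc_right)
  \<comment> \<open>As a member of \<open>F\<close>, \<open>?e\<close> would have product 0 with
    itself, while that product is 1.\<close>
  moreover have "?e \<notin> F" using calculation by force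
  ultimately show ?thesis using assms(1) by auto
qed

text \<open>Subtract from the new vector its expansion in the system built so far. A zero remainder
  means that the span does not grow; otherwise the normalised remainder is adjoined.\<close>

lemma gram_schmidt:
  assumes "finite S"
  shows "\<exists>F. finite F \<and> orthonormal F \<and> vs.span F = vs.span S"
  using assms
proof (induction S)
  case empty
  show ?case by (intro exI[of _ "{}"]) auto
next
  case (insert a S)
  then obtain F where F: "finite F" "orthonormal F" "vs.span F = vs.span S" by blast
  define w where "w = (\<Sum>e\<in>F. sc (ip a e) e)"
  define u where "u = a - w"
  have w: "w \<in> vs.span S" unfolding w_def F(3)[symmetric] by (rule expansion_in_span)
  show ?case
  proof (cases "u = 0")
    case True
    then have "a \<in> vs.span S" using w by (simp add: u_def)
    then have "vs.span (insert a S) = vs.span S" by (rule vs.span_redundant)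
    then show ?thesis using F by (intro exI[of _ F]) metis
  next
    case False
    define c where "c = (of_real (inverse (norm u)) :: 'k)"
    have c: "c \<noteq> 0" using False by (simp add: c_def)
    have on: "orthonormal (insert (sc c u) F)" unfolding c_def
      using diff_expansion_orth[OF F(1,2), of a] orth_span False
      by (intro orthonormal_insert F) (auto simp: u_def w_def)
    have "vs.span (insert a S) = vs.span (insert u S)"
      by (rule vs.eq_span_insert_eq) (simp add: u_def w)
    also have "\<dots> = vs.span (insert (sc c u) F)"
    proof -
      have "sc (inverse c) (sc c u) \<in> vs.span (insert (sc c u) F)"
        by (intro vs.span_scale vs.span_base) auto
      then have "u \<in> vs.span (insert (sc c u) F)" using c by simp
      moreover have "S \<subseteq> vs.span (insert (sc c u) F)"
        using F(3) vs.span_superset[of S] vs.span_mono[of F "insert (sc c u) F"] by auto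
      moreover have "sc c u \<in> vs.span (insert u S)" 
        by (intro vs.span_scale vs.span_base) auto
      moreover have "F \<subseteq> vs.span (insert u S)"
        using F(3) vs.span_superset[of F] vs.span_mono[of S "insert u S"] by auto
      ultimately show ?thesis by (auto simp: vs.span_eq)
    qed
    finally show ?thesis using on F(1) by (intro exI[of _ "insert (sc c u) F"]) auto
  qed
qed

lemma fin_dim_subspaceE:
  assumes "fin_dim_subspace H V"
  obtains F where "finite F" "orthonormal F" "V = vs.span F"
  using assms gram_schmidt unfolding fin_dim_subspace_def dim_at_most_def by metis

lemma subspace_closed_proper_orth:
  assumes "sub V" "closed V" "V \<noteq> UNIV"
  shows "\<exists>u. u \<in> orth H V \<and> u \<noteq> 0"
proof -
  obtain x where "x \<notin> V" using assms by auto
  then show ?thesis using proj_orth[OF assms(1,2), of x] proj_in[OF assms(1,2), of x]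
    by (intro exI[of _ "x - proj H V x"]) auto
qed

text \<open>Zorn yields a maximal orthonormal set. Were its span not dense, a unit vector orthogonal
  to it could be adjoined.\<close>

lemma ex_onb: "\<exists>E. is_onb H E"
proof -
  let ?A = "{E. orthonormal E}"
  have "\<exists>M\<in>?A. \<forall>X\<in>?A. M \<subseteq> X \<longrightarrow> X = M"
  proof (rule subset_Zorn)
    fix C assume C: "subset.chain ?A C"
    have "orthonormal (\<Union>C)"
    proof (intro ballI)
      fix e f assume "e \<in> \<Union>C" "f \<in> \<Union>C"
      then obtain X Y where XY: "X \<in> C" "Y \<in> C" "e \<in> X" "f \<in> Y" by blast
      have sub: "C \<subseteq> ?A" and tot: "X \<subseteq> Y \<or> Y \<subseteq> X"
        using C XY unfolding subset_chain_def by simp_all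
      from tot obtain Z where Z: "Z \<in> C" "e \<in> Z" "f \<in> Z" using XY by blast
      then have "orthonormal Z" using sub by blast
      with Z show "ip e f = (if e = f then 1 else 0)" by simp
    qed
    then show "\<exists>U\<in>?A. \<forall>X\<in>C. X \<subseteq> U" by (intro bexI[of _ "\<Union>C"]) auto
  qed
  then obtain E where E: "orthonormal E" and max: "\<And>X. orthonormal X \<Longrightarrow> E \<subseteq> X \<Longrightarrow> X = E"
    by (elim bexE) simp
  have "closure (vs.span E) = UNIV"
  proof (rule ccontr)
    assume "closure (vs.span E) \<noteq> UNIV"
    then obtain u where "u \<in> orth H (closure (vs.span E))" and u0: "u \<noteq> 0"
      using subspace_closed_proper_orth[OF subspace_closure[OF vs.subspace_span]] by blast
    then have u: "u \<in> orth H E" by (simp add: orth_closure orth_span)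
    define c where "c = (of_real (inverse (norm u)) :: 'k)"
    have "orthonormal (insert (sc c u) E)" unfolding c_def by (rule orthonormal_insert[OF E u u0])
    from max[OF this] have "sc c u \<in> E" by auto
    then have "ip u (sc c u) = 0" using u orthD by blast
    then show False using u0 by (simp add: ip_sc_right c_def)
  qed
  with E show ?thesis unfolding is_onb_def by (intro exI[of _ E] conjI)
qed

text \<open>By the Bessel identity the deficit of a finite partial sum is the squared distance from
  \<open>x\<close> to a finite-dimensional span, which becomes small since the full span is
  dense.\<close>

lemma parseval:
  assumes "is_onb H E"
  shows "((\<lambda>e. (norm (ip x e))\<^sup>2) has_sum (norm x)\<^sup>2) E"
  unfolding has_sum_def tendsto_iff eventually_finite_subsets_at_top
proof (intro allI impI)
  fix d :: real assume d: "d > 0"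
  have on: "orthonormal E" and cl: "closure (vs.span E) = UNIV"
    using assms by (auto simp: is_onb_def)
  \<comment> \<open>Accuracy \<open>sqrt d\<close>, because the deficit is a squared distance. Every
    finite set containing the support \<open>G\<close> of \<open>v\<close> approximates
    \<open>x\<close> at least as well as \<open>v\<close> does.\<close>
  obtain v where v: "v \<in> vs.span E" "dist v x < sqrt d"
    using cl d closure_approachable[of x "vs.span E"] by (metis UNIV_I real_sqrt_gt_0_iff)
  then obtain G r where G: "finite G" "G \<subseteq> E" "v = (\<Sum>a\<in>G. sc (r a) a)"
    unfolding vs.span_explicit by blast
  show "\<exists>X. finite X \<and> X \<subseteq> E \<and> (\<forall>Y. finite Y \<and> X \<subseteq> Y \<and> Y \<subseteq> E \<longrightarrow>
      dist (\<Sum>e\<in>Y. (norm (ip x e))\<^sup>2) ((norm x)\<^sup>2) < d)"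
  proof (intro exI[of _ G] conjI allI impI)
    fix F assume F: "finite F \<and> G \<subseteq> F \<and> F \<subseteq> E"
    then have onF: "finite F" "orthonormal F" using on by (auto simp: subset_iff)
    have "v \<in> vs.span F" unfolding G(3) using F
      by (intro vs.span_sum vs.span_scale vs.span_base) auto
    from norm_diff_proj_le[OF vs.subspace_span closed_span_orthonormal[OF onF] this, of x]
    have "norm (x - (\<Sum>e\<in>F. sc (ip x e) e)) < sqrt d"
      using v by (simp add: proj_span[OF onF] dist_norm norm_minus_commute)
    then have "(norm (x - (\<Sum>e\<in>F. sc (ip x e) e)))\<^sup>2 < d"
      using d power_strict_mono[of "norm (x - (\<Sum>e\<in>F. sc (ip x e) e))" "sqrt d" 2] by simp
    then show "dist (\<Sum>e\<in>F. (norm (ip x e))\<^sup>2) ((norm x)\<^sup>2) < d"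
      using bessel_identity[OF onF, of x] by (simp add: dist_real_def)
  qed (use G in auto)
qed

end

section \<open>Algebra of bounded operators\<close>

lemma bounded_ops_iff:
  "hilbert_space H \<Longrightarrow> hilbert_space K \<Longrightarrow> T \<in> bounded_ops H K \<longleftrightarrow>
    (\<forall>x y. T (x + y) = T x + T y) \<and> (\<forall>c x. T (scl H c x) = scl K c (T x)) \<and> bounded_linear T"
  by (auto simp: bounded_ops_def linear_iff_scl)

lemma bounded_ops_bounded_linear: "T \<in> bounded_ops H K \<Longrightarrow> bounded_linear T"
  by (simp add: bounded_ops_def)

lemma bounded_ops_compose:
  assumes "hilbert_space H" "hilbert_space K" "hilbert_space L"
    and "T \<in> bounded_ops H K" "S \<in> bounded_ops K L"
  shows "S \<circ> T \<in> bounded_ops H L"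
  using assms bounded_linear_compose[of S T] by (auto simp: bounded_ops_iff o_def)

lemma bounded_ops_diff:
  assumes "hilbert_space H" "hilbert_space K" "T \<in> bounded_ops H K" "S \<in> bounded_ops H K"
  shows "(\<lambda>x. T x - S x) \<in> bounded_ops H K"
proof -
  interpret K: hilbert_space K by fact
  show ?thesis using assms bounded_linear_sub[of T S]
    by (auto simp: bounded_ops_iff K.vs.scale_right_diff_distrib)
qed

lemma hs_ops_bounded: "T \<in> hs_ops H K \<Longrightarrow> T \<in> bounded_ops H K"
  by (simp add: hs_ops_def)

lemma hs_norm_nonneg: "hs_norm H T \<ge> 0"
  by (simp add: hs_norm_def infsum_nonneg)

context hilbert_space
begin

lemma norm_ip_commute: "norm (ip x y) = norm (ip y x)"
  by (simp add: ipr_commute[of y x])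

section \<open>Dimension bounds and increasing families of subspaces\<close>

text \<open>A maximal independent subset of \<open>W\<close> is a basis of it, and the exchange
  lemma bounds its size by that of a spanning set of \<open>V\<close>.\<close>

lemma dim_at_most_subset:
  assumes "sub W" "W \<subseteq> V" "dim_at_most H V r"
  shows "dim_at_most H W r"
proof -
  obtain E where E: "finite E" "vs.span E = V" "card E \<le> r"
    using assms by (auto simp: dim_at_most_def)
  obtain B where B: "B \<subseteq> W" "vs.independent B" "W \<subseteq> vs.span B"
    using vs.maximal_independent_subset by blast
  have "finite B \<and> card B \<le> card E"
    by (rule vs.independent_span_bound) (use E B assms in auto)
  moreover have "vs.span B = W" using B assms(1) vs.span_minimal by blast
  ultimately show ?thesis using B E unfolding dim_at_most_def
    by (intro exI[of _ B]) auto
qed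

lemma dim_at_most_span:
  assumes "finite S" "card S \<le> r"
  shows "dim_at_most H (vs.span S) r"
proof -
  obtain B where B: "B \<subseteq> S" "vs.independent B" "S \<subseteq> vs.span B"
    using vs.maximal_independent_subset by blast
  have "card B \<le> card S" "finite B" using assms B card_mono finite_subset by blast+
  moreover have "vs.span B = vs.span S" using B by (meson vs.span_eq vs.span_superset subset_trans)
  ultimately show ?thesis using B assms unfolding dim_at_most_def
    by (intro exI[of _ B]) auto
qed

lemma dim_at_most_subspace: "dim_at_most H V r \<Longrightarrow> sub V"
  unfolding dim_at_most_def using vs.subspace_span by blast

lemma fin_dim_subspace_closed: "fin_dim_subspace H V \<Longrightarrow> closed V"
  by (elim fin_dim_subspaceE) (simp add: closed_span_orthonormal)

lemma fin_dim_subspace_sub: "fin_dim_subspace H V \<Longrightarrow> sub V"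
  by (simp add: fin_dim_subspace_def)

lemma dim_at_most_fin_dim: "dim_at_most H V r \<Longrightarrow> fin_dim_subspace H V"
  using dim_at_most_subspace by (auto simp: fin_dim_subspace_def)

lemma subspace_UN_mono:
  assumes "\<And>n::nat. sub (X n)" "mono X"
  shows "sub (\<Union>n. X n)"
proof (rule vs.subspaceI)
  fix x y assume "x \<in> (\<Union>n. X n)" "y \<in> (\<Union>n. X n)"
  then obtain m n where "x \<in> X m" "y \<in> X n" by auto
  then have "x \<in> X (max m n)" "y \<in> X (max m n)" using assms(2)
    by (meson monoD max.cobounded1 max.cobounded2 subsetD)+
  then show "x + y \<in> (\<Union>n. X n)" using vs.subspace_add[OF assms(1)] by blast
next
  fix c x assume "x \<in> (\<Union>n. X n)"
  then show "sc c x \<in> (\<Union>n. X n)" using vs.subspace_scale[OF assms(1)] by auto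
qed (use vs.subspace_0[OF assms(1)] in auto)

text \<open>An approximant \<open>v\<close> from \<open>X N\<close> stays in all later spaces, and
  the projections are best approximations.\<close>

lemma proj_tendsto:
  assumes X: "\<And>n::nat. sub (X n)" "\<And>n. closed (X n)" "mono X" and x: "x \<in> closure (\<Union>n. X n)"
  shows "(\<lambda>n. proj H (X n) x) \<longlonglongrightarrow> x"
proof (rule metric_LIMSEQ_I)
  fix e :: real assume "e > 0"
  then obtain v N where v: "v \<in> X N" "dist v x < e"
    using x unfolding closure_approachable by blast
  have "dist (proj H (X n) x) x < e" if "n \<ge> N" for n
  proof -
    have "v \<in> X n" using v that X(3) by (meson monoD subsetD)
    then have "norm (x - proj H (X n) x) \<le> norm (x - v)" by (rule norm_diff_proj_le[OF X(1,2)])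
    then show ?thesis using v by (simp add: dist_norm norm_minus_commute)
  qed
  then show "\<exists>N. \<forall>n\<ge>N. dist (proj H (X n) x) x < e" by blast
qed

text \<open>\<open>y - proj H W y\<close> is orthogonal to \<open>W\<close>, hence to
  \<open>V\<close>, and is therefore killed by the projector onto \<open>V\<close>.\<close>

lemma proj_proj_subset:
  assumes "sub V" "closed V" "sub W" "closed W" "V \<subseteq> W"
  shows "proj H V (proj H W y) = proj H V y"
proof -
  have "y - proj H W y \<in> orth H V"
    using proj_orth[OF assms(3,4)] assms(5) by (auto simp: orth_def)
  then have "proj H V (y - proj H W y) = 0" by (rule proj_eq_0[OF assms(1)])
  then have "proj H V ((y - proj H W y) + proj H W y) = proj H V (proj H W y)"
    using proj_add[OF assms(1,2), of "y - proj H W y" "proj H W y"] by simp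
  then show ?thesis by simp
qed

lemma expansion_in_orthonormal_span:
  assumes "finite F" "orthonormal F" "x \<in> vs.span F"
  shows "x = (\<Sum>e\<in>F. sc (ip x e) e)"
  using proj_span[OF assms(1,2), of x] proj_id[of "vs.span F" x] assms(3) by simp

end

section \<open>Linear operators between two spaces and their adjoints\<close>

locale hilbert_pair = H: hilbert_space H + K: hilbert_space K
  for H :: "('k::rc_field, 'a::{real_inner,complete_space}) hilb"
    and K :: "('k, 'b::{real_inner,complete_space}) hilb"
begin

lemma bounded_ops_add: "T \<in> bounded_ops H K \<Longrightarrow> T (x + y) = T x + T y"
  and bounded_ops_sc: "T \<in> bounded_ops H K \<Longrightarrow> T (scl H c x) = scl K c (T x)"
  by (simp_all add: bounded_ops_iff H.hilbert_space_axioms K.hilbert_space_axioms)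

lemma bounded_ops_zero: "T \<in> bounded_ops H K \<Longrightarrow> T 0 = 0"
  using bounded_ops_add[of T 0 0] by simp

lemma bounded_ops_diff_arg: "T \<in> bounded_ops H K \<Longrightarrow> T (x - y) = T x - T y"
  using bounded_ops_add[of T "x - y" y] by simp

lemma subspace_ker: "T \<in> bounded_ops H K \<Longrightarrow> module.subspace (scl H) (ker T)"
  by (auto simp: ker_def H.vs.subspace_def bounded_ops_add bounded_ops_sc bounded_ops_zero)

lemma closed_ker: "T \<in> bounded_ops H K \<Longrightarrow> closed (ker T)"
  unfolding ker_def
  by (intro closed_Collect_eq continuous_on_const linear_continuous_on bounded_ops_bounded_linear)

lemma linear_ops_iff: "(D, T) \<in> linear_ops H K \<longleftrightarrow> H.sub D
     \<and> (\<forall>x\<in>D. \<forall>y\<in>D. T (x + y) = T x + T y)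
     \<and> (\<forall>c. \<forall>x\<in>D. T (scl H c x) = scl K c (T x))"
  by (simp add: linear_ops_def)

lemma bounded_ops_linear_ops: "T \<in> bounded_ops H K \<Longrightarrow> H.sub D \<Longrightarrow> (D, T) \<in> linear_ops H K"
  by (simp add: linear_ops_iff bounded_ops_add bounded_ops_sc)

lemma linear_ops_zero: "(D, T) \<in> linear_ops H K \<Longrightarrow> T 0 = 0"
  using H.vs.subspace_0[of D] unfolding linear_ops_iff by (metis add_cancel_left_left)

lemma linear_ops_sum:
  assumes "(D, T) \<in> linear_ops H K" "\<And>i. i \<in> I \<Longrightarrow> f i \<in> D"
  shows "T (\<Sum>i\<in>I. scl H (c i) (f i)) = (\<Sum>i\<in>I. scl K (c i) (T (f i)))"
  using assms(2)
proof (induction I rule: infinite_finite_induct)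
  case (insert i I)
  have "scl H (c i) (f i) \<in> D" "(\<Sum>i\<in>I. scl H (c i) (f i)) \<in> D"
    using assms(1) insert.prems unfolding linear_ops_iff
    by (auto intro!: H.vs.subspace_sum H.vs.subspace_scale)
  with insert assms(1) show ?case by (simp add: linear_ops_iff)
qed (simp_all add: linear_ops_zero[OF assms(1)])

lemma subspace_image:
  assumes "(D, T) \<in> linear_ops H K" "H.sub V" "V \<subseteq> D"
  shows "K.sub (T ` V)"
proof (rule K.vs.subspaceI)
  show "0 \<in> T ` V" using linear_ops_zero[OF assms(1)] H.vs.subspace_0[OF assms(2)] by force
next
  fix x y assume "x \<in> T ` V" "y \<in> T ` V"
  then obtain u v where "u \<in> V" "v \<in> V" "x = T u" "y = T v" by blast
  moreover then have "T (u + v) = x + y" using assms by (auto simp: linear_ops_iff subset_iff)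
  ultimately show "x + y \<in> T ` V" using H.vs.subspace_add[OF assms(2)] by (metis imageI)
next
  fix c x assume "x \<in> T ` V"
  then obtain u where "u \<in> V" "x = T u" by blast
  moreover then have "T (scl H c u) = scl K c x" using assms by (auto simp: linear_ops_iff subset_iff)
  ultimately show "scl K c x \<in> T ` V" using H.vs.subspace_scale[OF assms(2)] by (metis imageI)
qed

text \<open>The image lies in the span of the images of a finite spanning set, and these are no more
  numerous than the set itself.\<close>

lemma dim_at_most_image:
  assumes T: "(D, T) \<in> linear_ops H K" and V: "dim_at_most H V r" "V \<subseteq> D"
  shows "dim_at_most K (T ` V) r"
proof -
  obtain E where E: "finite E" "H.vs.span E = V" "card E \<le> r"
    using V by (auto simp: dim_at_most_def)
  have "T ` V \<subseteq> K.vs.span (T ` E)"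
  proof
    fix y assume "y \<in> T ` V"
    then obtain u where u: "u \<in> H.vs.span E" "y = T u" using E by auto
    then obtain c where "u = (\<Sum>v\<in>E. scl H (c v) v)" using H.vs.span_finite[OF E(1)] by auto
    moreover have "E \<subseteq> D" using E V H.vs.span_superset by blast
    ultimately have "y = (\<Sum>v\<in>E. scl K (c v) (T v))"
      using linear_ops_sum[OF T, of E "\<lambda>v. v" c] u by auto
    also have "\<dots> \<in> K.vs.span (T ` E)"
      by (intro K.vs.span_sum K.vs.span_scale K.vs.span_base imageI)
    finally show "y \<in> K.vs.span (T ` E)" .
  qed
  moreover have "dim_at_most K (K.vs.span (T ` E)) r"
    using E by (intro K.dim_at_most_span) (auto intro: card_image_le order_trans)
  moreover have "K.sub (T ` V)"
    using subspace_image[OF T] H.dim_at_most_subspace V by blast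
  ultimately show ?thesis using K.dim_at_most_subset by blast
qed

lemma subspace_range: "T \<in> bounded_ops H K \<Longrightarrow> K.sub (range T)"
  by (rule subspace_image[OF bounded_ops_linear_ops[of T UNIV]]) auto

text \<open>Riesz representation for each \<open>y\<close> shows that the choice in
  \<open>adj\<close> has a witness.\<close>

lemma adj_ip:
  assumes "T \<in> bounded_ops H K"
  shows "ipr K (T x) y = ipr H x (adj H K T y)"
proof -
  have "\<exists>z. \<forall>x. ipr K (T x) y = ipr H x z" for y
  proof (rule H.riesz_representation)
    show "bounded_linear (\<lambda>x. ipr K (T x) y)"
      by (rule bounded_linear_compose[OF K.bounded_linear_ip bounded_ops_bounded_linear[OF assms]])
  qed (auto simp: bounded_ops_add[OF assms] bounded_ops_sc[OF assms] K.ipr_add_left K.ipr_scl_left)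
  then have "\<exists>S. \<forall>x y. ipr K (T x) y = ipr H x (S y)" by metis
  from someI_ex[OF this] show ?thesis unfolding adj_def by blast
qed

lemma adj_linear_ops:
  assumes "T \<in> bounded_ops H K"
  shows "(UNIV, adj H K T) \<in> linear_ops K H"
  unfolding linear_ops_def
  by (auto intro!: H.ip_eqI_right simp: adj_ip[OF assms, symmetric] H.ip_add_right K.ip_add_right
      H.ip_sc_right K.ip_sc_right)

section \<open>Hilbert--Schmidt norms\<close>

text \<open>Both sums equal the double sum of the squared moduli of \<open>ipr K (T e) f\<close>:
  Parseval in \<open>F\<close> sums the rows, Parseval in \<open>E\<close> the columns.\<close>

lemma hs_adjoint_has_sum:
  assumes adj: "\<And>x y. ipr K (T x) y = ipr H x (S y)" and E: "is_onb H E" and F: "is_onb K F"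
    and s: "((\<lambda>e. (norm (T e))\<^sup>2) has_sum s) E"
  shows "((\<lambda>f. (norm (S f))\<^sup>2) has_sum s) F"
proof (rule nonneg_has_sum_swap[OF _ _ _ s])
  fix f show "((\<lambda>e. (norm (ipr K (T e) f))\<^sup>2) has_sum (norm (S f))\<^sup>2) E"
    using H.parseval[OF E, of "S f"] unfolding adj H.norm_ip_commute[of "S f"] .
qed (auto intro: K.parseval[OF F])

text \<open>Passing from the given basis to the adjoint and back to an arbitrary basis shows that
  every basis yields the same sum; the basis chosen by \<open>SOME\<close> in \<open>hs_norm\<close>
  is one of them.\<close>

lemma hs_has_sum:
  assumes T: "T \<in> hs_ops H K"
  shows "is_onb H E \<Longrightarrow> ((\<lambda>e. (norm (T e))\<^sup>2) has_sum (hs_norm H T)\<^sup>2) E" (is "_ \<Longrightarrow> ?A")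
    and "is_onb K F \<Longrightarrow> ((\<lambda>f. (norm (adj H K T f))\<^sup>2) has_sum (hs_norm H T)\<^sup>2) F" (is "_ \<Longrightarrow> ?B")
proof -
  interpret swap: hilbert_pair K H by unfold_locales
  have Tb: "T \<in> bounded_ops H K" using T by (rule hs_ops_bounded)
  obtain E0 where E0: "is_onb H E0" "(\<lambda>e. (norm (T e))\<^sup>2) summable_on E0"
    using T by (auto simp: hs_ops_def)
  then obtain s where s: "((\<lambda>e. (norm (T e))\<^sup>2) has_sum s) E0" by (auto simp: summable_on_def)
  obtain F0 where F0: "is_onb K F0" using K.ex_onb by blast
  have adj': "ipr H (adj H K T y) x = ipr K y (T x)" for x y
    by (metis adj_ip[OF Tb] H.ipr_commute K.ipr_commute)
  have F: "((\<lambda>f. (norm (adj H K T f))\<^sup>2) has_sum s) F" if "is_onb K F" for F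
    by (rule hs_adjoint_has_sum[OF adj_ip[OF Tb] E0(1) that s])
  have E: "((\<lambda>e. (norm (T e))\<^sup>2) has_sum s) E" if "is_onb H E" for E
    by (rule swap.hs_adjoint_has_sum[OF adj' F0 that F[OF F0]])
  have "is_onb H (SOME E. is_onb H E)" using someI_ex[OF H.ex_onb] .
  from infsumI[OF E[OF this]] have "(hs_norm H T)\<^sup>2 = s"
    using has_sum_nonneg[OF s] by (simp add: hs_norm_def)
  with E F show "is_onb H E \<Longrightarrow> ?A" "is_onb K F \<Longrightarrow> ?B" by auto
qed

lemma hs_opsI:
  assumes "T \<in> bounded_ops H K" "is_onb H E" "((\<lambda>e. (norm (T e))\<^sup>2) has_sum s) E"
  shows "T \<in> hs_ops H K" "(hs_norm H T)\<^sup>2 = s"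
proof -
  show T: "T \<in> hs_ops H K" using assms unfolding hs_ops_def summable_on_def by blast
  show "(hs_norm H T)\<^sup>2 = s" using hs_has_sum(1)[OF T assms(2)] assms(3) has_sum_unique by blast
qed

text \<open>Lets the norm be computed from the adjoint, where a projector composed on the right acts
  on the values.\<close>

lemma hs_opsI_adjoint:
  assumes T: "T \<in> bounded_ops H K" and adj: "\<And>x y. ipr K (T x) y = ipr H x (S y)"
    and F: "is_onb K F" and s: "((\<lambda>f. (norm (S f))\<^sup>2) has_sum s) F"
  shows "T \<in> hs_ops H K" "(hs_norm H T)\<^sup>2 = s"
proof -
  interpret swap: hilbert_pair K H by unfold_locales
  obtain E where E: "is_onb H E" using H.ex_onb by blast
  have adj': "ipr H (S y) x = ipr K y (T x)" for x y
    by (metis adj H.ipr_commute K.ipr_commute)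
  have "((\<lambda>e. (norm (T e))\<^sup>2) has_sum s) E"
    by (rule swap.hs_adjoint_has_sum[OF adj' F E s])
  from hs_opsI[OF T E this] show "T \<in> hs_ops H K" "(hs_norm H T)\<^sup>2 = s" by auto
qed

text \<open>Minkowski's inequality on finite subsets of a basis gives one uniform bound, from which
  both summability and the norm estimate follow.\<close>

lemma hs_diff:
  assumes T: "T \<in> hs_ops H K" and S: "S \<in> hs_ops H K"
  shows "(\<lambda>x. T x - S x) \<in> hs_ops H K"
    and "hs_norm H (\<lambda>x. T x - S x) \<le> hs_norm H T + hs_norm H S"
proof -
  obtain E where E: "is_onb H E" using H.ex_onb by blast
  have bound: "(\<Sum>e\<in>F. (norm (T e - S e))\<^sup>2) \<le> (hs_norm H T + hs_norm H S)\<^sup>2"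
    if F: "finite F" "F \<subseteq> E" for F
  proof -
    have le: "L2_set (\<lambda>e. norm (R e)) F \<le> hs_norm H R" if "R \<in> hs_ops H K" for R
      unfolding L2_set_def
      by (rule real_le_lsqrt)
        (use finite_sum_le_has_sum[OF hs_has_sum(1)[OF that E] F] hs_norm_nonneg in auto)
    have "L2_set (\<lambda>e. norm (T e - S e)) F \<le> L2_set (\<lambda>e. norm (T e) + norm (S e)) F"
      by (rule L2_set_mono) (auto simp: norm_triangle_ineq4)
    also have "\<dots> \<le> L2_set (\<lambda>e. norm (T e)) F + L2_set (\<lambda>e. norm (S e)) F"
      by (rule L2_set_triangle_ineq)
    also have "\<dots> \<le> hs_norm H T + hs_norm H S" using le[OF T] le[OF S] by simp
    finally have "(L2_set (\<lambda>e. norm (T e - S e)) F)\<^sup>2 \<le> (hs_norm H T + hs_norm H S)\<^sup>2"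
      by (intro power_mono L2_set_nonneg)
    then show ?thesis by (simp add: L2_set_def sum_nonneg)
  qed
  have "(\<lambda>e. (norm (T e - S e))\<^sup>2) summable_on E"
    by (rule nonneg_bdd_above_summable_on)
      (auto intro!: bdd_aboveI2[where M = "(hs_norm H T + hs_norm H S)\<^sup>2"] bound)
  then obtain s where s: "((\<lambda>e. (norm (T e - S e))\<^sup>2) has_sum s) E" by (auto simp: summable_on_def)
  have b: "(\<lambda>x. T x - S x) \<in> bounded_ops H K"
    by (intro bounded_ops_diff hs_ops_bounded T S H.hilbert_space_axioms K.hilbert_space_axioms)
  show "(\<lambda>x. T x - S x) \<in> hs_ops H K" by (rule hs_opsI[OF b E s])
  have "(hs_norm H (\<lambda>x. T x - S x))\<^sup>2 \<le> (hs_norm H T + hs_norm H S)\<^sup>2"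
    unfolding hs_opsI(2)[OF b E s] by (rule has_sum_le_finite_sums[OF s bound])
  then show "hs_norm H (\<lambda>x. T x - S x) \<le> hs_norm H T + hs_norm H S"
    by (rule power2_le_imp_le) (simp add: hs_norm_nonneg)
qed

text \<open>All summands vanish, so the closed kernel contains a basis and with it the closure of
  its span.\<close>

lemma hs_norm_eq_0:
  assumes "T \<in> hs_ops H K" "hs_norm H T = 0"
  shows "T x = 0"
proof -
  obtain E where E: "is_onb H E" using H.ex_onb by blast
  have T: "T \<in> bounded_ops H K" using assms hs_ops_bounded by blast
  have z: "T e = 0" if "e \<in> E" for e
    using nonneg_has_sum_le_0D[OF hs_has_sum(1)[OF assms(1) E], of e] assms(2) that by simp
  have "H.vs.span E \<subseteq> ker T"
    by (rule H.vs.span_minimal[OF _ subspace_ker[OF T]]) (use z in \<open>auto simp: ker_def\<close>)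
  then have "closure (H.vs.span E) \<subseteq> ker T" by (rule closure_minimal[OF _ closed_ker[OF T]])
  then show ?thesis using E unfolding is_onb_def by (auto simp: ker_def)
qed

text \<open>Pythagoras for every \<open>T e\<close>, summed over a basis.\<close>

lemma hs_proj_left:
  assumes T: "T \<in> hs_ops H K" and V: "K.sub V" "closed V"
  shows "(\<lambda>x. proj K V (T x)) \<in> hs_ops H K" "(\<lambda>x. T x - proj K V (T x)) \<in> hs_ops H K"
    and "(hs_norm H T)\<^sup>2 = (hs_norm H (\<lambda>x. proj K V (T x)))\<^sup>2
      + (hs_norm H (\<lambda>x. T x - proj K V (T x)))\<^sup>2"
proof -
  obtain E where E: "is_onb H E" using H.ex_onb by blast
  have b: "(\<lambda>x. proj K V (T x)) \<in> bounded_ops H K"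
    using bounded_ops_compose[OF H.hilbert_space_axioms K.hilbert_space_axioms K.hilbert_space_axioms
        hs_ops_bounded[OF T] K.proj_bounded[OF V]] by (simp add: o_def)
  have b': "(\<lambda>x. T x - proj K V (T x)) \<in> bounded_ops H K"
    by (intro bounded_ops_diff hs_ops_bounded T b H.hilbert_space_axioms K.hilbert_space_axioms)
  obtain t u where tu: "((\<lambda>e. (norm (proj K V (T e)))\<^sup>2) has_sum t) E"
    "((\<lambda>e. (norm (T e - proj K V (T e)))\<^sup>2) has_sum u) E" "(hs_norm H T)\<^sup>2 = t + u"
    by (rule has_sum_split[OF hs_has_sum(1)[OF T E] K.proj_pythagoras[OF V]]) auto
  show "(\<lambda>x. proj K V (T x)) \<in> hs_ops H K" by (rule hs_opsI[OF b E tu(1)])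
  show "(\<lambda>x. T x - proj K V (T x)) \<in> hs_ops H K" by (rule hs_opsI[OF b' E tu(2)])
  show "(hs_norm H T)\<^sup>2 = (hs_norm H (\<lambda>x. proj K V (T x)))\<^sup>2
      + (hs_norm H (\<lambda>x. T x - proj K V (T x)))\<^sup>2"
    using hs_opsI(2)[OF b E tu(1)] hs_opsI(2)[OF b' E tu(2)] tu(3) by simp
qed

text \<open>The adjoint of \<open>T\<close> after the projector is the projector after the adjoint
  of \<open>T\<close>, so Pythagoras is applied to the values of the adjoint.\<close>

lemma hs_proj_right:
  assumes T: "T \<in> hs_ops H K" and V: "H.sub V" "closed V"
  shows "(\<lambda>x. T (proj H V x)) \<in> hs_ops H K" "(\<lambda>x. T x - T (proj H V x)) \<in> hs_ops H K"
    and "(hs_norm H T)\<^sup>2 = (hs_norm H (\<lambda>x. T (proj H V x)))\<^sup>2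
      + (hs_norm H (\<lambda>x. T x - T (proj H V x)))\<^sup>2"
proof -
  obtain F where F: "is_onb K F" using K.ex_onb by blast
  let ?S = "adj H K T"
  note Tb = hs_ops_bounded[OF T]
  have b: "(\<lambda>x. T (proj H V x)) \<in> bounded_ops H K"
    using bounded_ops_compose[OF H.hilbert_space_axioms H.hilbert_space_axioms K.hilbert_space_axioms
        H.proj_bounded[OF V] Tb] by (simp add: o_def)
  have b': "(\<lambda>x. T x - T (proj H V x)) \<in> bounded_ops H K"
    by (intro bounded_ops_diff hs_ops_bounded T b H.hilbert_space_axioms K.hilbert_space_axioms)
  have a: "ipr K (T (proj H V x)) y = ipr H x (proj H V (?S y))" for x y
    by (simp add: adj_ip[OF Tb] H.ip_proj[OF V])
  have a': "ipr K (T x - T (proj H V x)) y = ipr H x (?S y - proj H V (?S y))" for x y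
    by (simp add: K.ip_diff_left H.ip_diff_right a) (simp add: adj_ip[OF Tb])
  obtain t u where tu: "((\<lambda>e. (norm (proj H V (?S e)))\<^sup>2) has_sum t) F"
    "((\<lambda>e. (norm (?S e - proj H V (?S e)))\<^sup>2) has_sum u) F" "(hs_norm H T)\<^sup>2 = t + u"
    by (rule has_sum_split[OF hs_has_sum(2)[OF T F] H.proj_pythagoras[OF V]]) auto
  show "(\<lambda>x. T (proj H V x)) \<in> hs_ops H K" by (rule hs_opsI_adjoint[OF b a F tu(1)])
  show "(\<lambda>x. T x - T (proj H V x)) \<in> hs_ops H K" by (rule hs_opsI_adjoint[OF b' a' F tu(2)])
  show "(hs_norm H T)\<^sup>2 = (hs_norm H (\<lambda>x. T (proj H V x)))\<^sup>2
      + (hs_norm H (\<lambda>x. T x - T (proj H V x)))\<^sup>2"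
    using hs_opsI_adjoint(2)[OF b a F tu(1)] hs_opsI_adjoint(2)[OF b' a' F tu(2)] tu(3) by simp
qed

text \<open>Expanding \<open>T e\<close> in \<open>F\<close> and interchanging the finite sum over
  \<open>F\<close> with the sum over a basis leaves Parseval for each \<open>S f\<close>.\<close>

lemma hs_finite_rank:
  assumes T: "T \<in> bounded_ops H K" and F: "finite F" "K.orthonormal F" "range T \<subseteq> K.vs.span F"
    and adj: "\<And>x y. ipr K (T x) y = ipr H x (S y)"
  shows "T \<in> hs_ops H K" "(hs_norm H T)\<^sup>2 = (\<Sum>f\<in>F. (norm (S f))\<^sup>2)"
proof -
  obtain E where E: "is_onb H E" using H.ex_onb by blast
  have eq: "(norm (T e))\<^sup>2 = (\<Sum>f\<in>F. (norm (ipr H (S f) e))\<^sup>2)" for e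
  proof -
    have "T e \<in> K.vs.span F" using F(3) by blast
    from K.expansion_in_orthonormal_span[OF F(1,2) this]
    have "(norm (T e))\<^sup>2 = (norm (\<Sum>f\<in>F. scl K (ipr K (T e) f) f))\<^sup>2" by metis
    also have "\<dots> = (\<Sum>f\<in>F. (norm (ipr K (T e) f))\<^sup>2)" by (rule K.norm_sum_orthonormal[OF F(1,2)])
    finally show ?thesis unfolding adj H.norm_ip_commute[of e] .
  qed
  have "((\<lambda>e. \<Sum>f\<in>G. (norm (ipr H (S f) e))\<^sup>2) has_sum (\<Sum>f\<in>G. (norm (S f))\<^sup>2)) E" if "finite G" for G
    using that by induction (auto intro!: has_sum_add H.parseval[OF E])
  from this[OF F(1)] have "((\<lambda>e. (norm (T e))\<^sup>2) has_sum (\<Sum>f\<in>F. (norm (S f))\<^sup>2)) E"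
    unfolding eq .
  from hs_opsI[OF T E this] show "T \<in> hs_ops H K" "(hs_norm H T)\<^sup>2 = (\<Sum>f\<in>F. (norm (S f))\<^sup>2)"
    by auto
qed

lemma bounded_rank_hs:
  assumes "T \<in> bounded_rank_ops H K r"
  shows "T \<in> hs_ops H K"
proof -
  have T: "T \<in> bounded_ops H K" "dim_at_most K (range T) r"
    using assms by (auto simp: bounded_rank_ops_def)
  obtain F where F: "finite F" "K.orthonormal F" "range T = K.vs.span F"
    by (rule K.fin_dim_subspaceE[OF K.dim_at_most_fin_dim[OF T(2)]])
  show ?thesis by (rule hs_finite_rank(1)[OF T(1) F(1,2) _ adj_ip[OF T(1)]]) (simp add: F(3))
qed


section \<open>Moore--Penrose and outer inverses\<close>

text \<open>On the finite-dimensional \<open>V\<close> the map \<open>L\<close> is controlled by its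
  values on an orthonormal basis. This is how a Moore-Penrose inverse, possibly unbounded on its
  whole domain, enters a bounded operator.\<close>

lemma finite_rank_compose_bounded:
  assumes R: "R \<in> bounded_ops H0 H" "hilbert_space H0" and V: "fin_dim_subspace H V" "range R \<subseteq> V"
    and L: "(V, L) \<in> linear_ops H K"
  shows "L \<circ> R \<in> bounded_ops H0 K"
proof -
  interpret H0: hilbert_space H0 by fact
  interpret R: hilbert_pair H0 H by unfold_locales
  obtain F where F: "finite F" "H.orthonormal F" "V = H.vs.span F"
    using V(1) by (rule H.fin_dim_subspaceE)
  obtain b where b: "\<And>x. norm (R x) \<le> norm x * b"
    using bounded_linear.bounded[OF bounded_ops_bounded_linear[OF R(1)]] by blast
  have Rx: "R x \<in> V" for x using V(2) by blast
  have "norm (L (R x)) \<le> norm x * (b * (\<Sum>f\<in>F. norm f * norm (L f)))" for x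
  proof -
    have "L (R x) = L (\<Sum>f\<in>F. scl H (ipr H (R x) f) f)"
      using H.expansion_in_orthonormal_span[OF F(1,2), of "R x"] Rx[of x] F(3) by simp
    also have "\<dots> = (\<Sum>f\<in>F. scl K (ipr H (R x) f) (L f))"
      using F(3) H.vs.span_base by (intro linear_ops_sum[OF L]) auto
    also have "norm \<dots> \<le> (\<Sum>f\<in>F. norm (scl K (ipr H (R x) f) (L f)))"
      by (rule norm_sum)
    also have "\<dots> \<le> (\<Sum>f\<in>F. (norm x * b) * (norm f * norm (L f)))"
    proof (rule sum_mono)
      fix f
      have "norm (ipr H (R x) f) \<le> norm x * b * norm f"
        using H.norm_ip_le[of "R x" f] mult_right_mono[OF b[of x] norm_ge_zero[of f]] by linarith
      then show "norm (scl K (ipr H (R x) f) (L f)) \<le> (norm x * b) * (norm f * norm (L f))"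
        using mult_right_mono[of _ _ "norm (L f)"] by (fastforce simp: K.norm_sc mult.assoc)
    qed
    finally show ?thesis by (simp add: sum_distrib_left mult.assoc)
  qed
  then show ?thesis
    using L Rx R.bounded_ops_add[OF R(1)] R.bounded_ops_sc[OF R(1)]
    by (intro H0.bounded_opsI[OF K.hilbert_space_axioms]) (auto simp: linear_ops_iff)
qed

text \<open>The projection differs from \<open>x\<close> by the kernel component of
  \<open>x\<close>.\<close>

lemma ker_orth_decomposition:
  assumes "T \<in> bounded_ops H K"
  shows "T (proj H (orth H (ker T)) x) = T x"
proof -
  have "proj H (ker T) x \<in> ker T"
    by (rule H.proj_in[OF subspace_ker[OF assms] closed_ker[OF assms]])
  then have "T (proj H (ker T) x) = 0" by (simp add: ker_def)
  then show ?thesis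
    by (simp add: H.proj_orth_complement[OF subspace_ker[OF assms] closed_ker[OF assms]]
        bounded_ops_diff_arg[OF assms])
qed

lemma inj_on_orth_ker:
  assumes "T \<in> bounded_ops H K"
  shows "inj_on T (orth H (ker T))"
proof (rule inj_onI)
  fix x y assume xy: "x \<in> orth H (ker T)" "y \<in> orth H (ker T)" "T x = T y"
  then have "x - y \<in> orth H (ker T)" using H.vs.subspace_diff[OF H.subspace_orth] by blast
  moreover have "x - y \<in> ker T" using xy(3) by (simp add: ker_def bounded_ops_diff_arg[OF assms])
  ultimately show "x = y" using H.orth_Int by fastforce
qed

text \<open>The description inside \<open>pinv\<close> is that of \<open>proj K (range T)\<close>,
  and \<open>proj_unique\<close> identifies it as \<open>T x\<close> even when the range is not
  closed.\<close>

lemma pinv_eq: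
  assumes T: "T \<in> bounded_ops H K" and x: "x \<in> orth H (ker T)" and k: "k \<in> orth K (range T)"
  shows "pinv H K T (T x + k) = x"
proof -
  have "(THE h. h \<in> range T \<and> T x + k - h \<in> orth K (range T)) = T x"
    using K.proj_unique[OF subspace_range[OF T], of "T x" "T x + k"] k by (simp add: proj_def)
  then show ?thesis
    unfolding pinv_def using inv_into_f_f[OF inj_on_orth_ker[OF T] x] by simp
qed

text \<open>Replacing a preimage by its projection onto the complement of the kernel gives a normal
  form to which \<open>pinv_eq\<close> applies.\<close>

lemma pinv_domE:
  assumes T: "T \<in> bounded_ops H K" and y: "y \<in> pinv_dom K T"
  obtains x k where "x \<in> orth H (ker T)" "k \<in> orth K (range T)" "y = T x + k"
proof -
  obtain u k where u: "y = T u + k" "k \<in> orth K (range T)" using y by (auto simp: pinv_dom_def)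
  have "proj H (orth H (ker T)) u \<in> orth H (ker T)"
    by (rule H.proj_in[OF H.subspace_orth H.closed_orth])
  with u that show ?thesis by (metis ker_orth_decomposition[OF T])
qed

lemma range_subset_pinv_dom: "range T \<subseteq> pinv_dom K T"
proof
  fix y assume "y \<in> range T"
  then have "\<exists>h k. y = h + k \<and> h \<in> range T \<and> k \<in> orth K (range T)"
    by (intro exI[of _ y] exI[of _ 0]) simp
  then show "y \<in> pinv_dom K T" by (simp add: pinv_dom_def)
qed

lemma pinv_in_orth_ker:
  assumes "T \<in> bounded_ops H K" "y \<in> pinv_dom K T"
  shows "pinv H K T y \<in> orth H (ker T)"
  using assms(2) by (elim pinv_domE[OF assms(1)]) (simp add: pinv_eq[OF assms(1)])

lemma pinv_linear_ops:
  assumes T: "T \<in> bounded_ops H K"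
  shows "(pinv_dom K T, pinv H K T) \<in> linear_ops K H"
proof -
  have add: "x + y \<in> pinv_dom K T \<and> pinv H K T (x + y) = pinv H K T x + pinv H K T y"
    if xD: "x \<in> pinv_dom K T" and yD: "y \<in> pinv_dom K T" for x y
  proof -
    obtain u k where u: "u \<in> orth H (ker T)" "k \<in> orth K (range T)" "x = T u + k"
      using xD by (rule pinv_domE[OF T])
    obtain v l where v: "v \<in> orth H (ker T)" "l \<in> orth K (range T)" "y = T v + l"
      using yD by (rule pinv_domE[OF T])
    have eq: "x + y = T (u + v) + (k + l)" by (simp add: bounded_ops_add[OF T] u v)
    have uv: "u + v \<in> orth H (ker T)" "k + l \<in> orth K (range T)"
      using u v H.vs.subspace_add[OF H.subspace_orth] K.vs.subspace_add[OF K.subspace_orth] by auto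
    have "pinv H K T x = u" "pinv H K T y = v"
      unfolding u(3) v(3) by (rule pinv_eq[OF T u(1,2)], rule pinv_eq[OF T v(1,2)])
    with pinv_eq[OF T uv] eq uv show ?thesis by (auto simp: pinv_dom_def)
  qed
  have scale: "scl K c x \<in> pinv_dom K T \<and> pinv H K T (scl K c x) = scl H c (pinv H K T x)"
    if xD: "x \<in> pinv_dom K T" for c x
  proof -
    obtain u k where u: "u \<in> orth H (ker T)" "k \<in> orth K (range T)" "x = T u + k"
      using xD by (rule pinv_domE[OF T])
    have eq: "scl K c x = T (scl H c u) + scl K c k"
      by (simp add: bounded_ops_sc[OF T] u K.vs.scale_right_distrib)
    have uv: "scl H c u \<in> orth H (ker T)" "scl K c k \<in> orth K (range T)"
      using u H.vs.subspace_scale[OF H.subspace_orth] K.vs.subspace_scale[OF K.subspace_orth] by auto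
    have "pinv H K T x = u" unfolding u(3) by (rule pinv_eq[OF T u(1,2)])
    with pinv_eq[OF T uv] eq uv show ?thesis by (auto simp: pinv_dom_def)
  qed
  have "0 \<in> pinv_dom K T"
    using range_subset_pinv_dom[of T] bounded_ops_zero[OF T] by (metis rangeI subsetD)
  with add scale show ?thesis by (auto simp: linear_ops_def intro!: K.vs.subspaceI)
qed

lemma pinv_apply:
  assumes T: "T \<in> bounded_ops H K"
  shows "pinv H K T (T x) = proj H (orth H (ker T)) x"
  using pinv_eq[OF T H.proj_in[OF H.subspace_orth H.closed_orth] K.zero_orth, of x]
  by (simp add: ker_orth_decomposition[OF T])

text \<open>In the normal form \<open>T x + k\<close> of \<open>y\<close>, the part \<open>k\<close>
  lies in the closure of the range and is orthogonal to it, hence is 0.\<close>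

lemma apply_pinv:
  assumes T: "T \<in> bounded_ops H K" and y: "y \<in> pinv_dom K T" "y \<in> closure (range T)"
  shows "T (pinv H K T y) = y"
proof -
  obtain x k where x: "x \<in> orth H (ker T)" "k \<in> orth K (range T)" "y = T x + k"
    using y(1) by (rule pinv_domE[OF T])
  have "T x \<in> closure (range T)" by (rule subsetD[OF closure_subset rangeI])
  then have "y - T x \<in> closure (range T)"
    using y(2) K.vs.subspace_diff[OF K.subspace_closure[OF subspace_range[OF T]]] by blast
  then have "k \<in> closure (range T)" by (simp add: x(3))
  moreover have "k \<in> orth K (closure (range T))" using x(2) by (simp add: K.orth_closure)
  ultimately have "k = 0" by (rule K.orth_Int)
  with pinv_eq[OF T x(1,2)] show ?thesis by (simp add: x(3))
qed

end

section \<open>The outer inverse attached to one finite-dimensional subspace\<close>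

locale outer_inverse = hilbert_pair H K
  for H :: "('k::rc_field, 'a::{real_inner,complete_space}) hilb"
    and K :: "('k, 'b::{real_inner,complete_space}) hilb" +
  fixes T :: "'a \<Rightarrow> 'b" and V :: "'b set"
  assumes T: "T \<in> bounded_ops H K" and fin: "fin_dim_subspace K V" and V: "V \<subseteq> closure (range T)"
begin

text \<open>This is the orthogonal complement of the kernel of the compression
  \<open>proj K V \<circ> T\<close>.\<close>

abbreviation X where "X \<equiv> adj H K T ` V"

lemma V_closed: "K.sub V" "closed V"
  using fin by (auto simp: K.fin_dim_subspace_closed K.fin_dim_subspace_sub)

lemma fin_X: "fin_dim_subspace H X"
proof -
  interpret swap: hilbert_pair K H by unfold_locales
  obtain r where "dim_at_most K V r" using fin by (auto simp: fin_dim_subspace_def)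
  then show ?thesis
    using swap.dim_at_most_image[OF adj_linear_ops[OF T]] H.dim_at_most_fin_dim by blast
qed

lemma X_closed: "H.sub X" "closed X"
  using fin_X by (auto simp: H.fin_dim_subspace_closed H.fin_dim_subspace_sub)

lemma proj_T: "proj K V (T (x - y)) = proj K V (T x) - proj K V (T y)"
proof -
  have "proj K V (T (x - y) + T y) = proj K V (T (x - y)) + proj K V (T y)"
    by (rule K.proj_add[OF V_closed])
  then show ?thesis by (simp add: bounded_ops_diff_arg[OF T])
qed

lemma compression_linear_ops: "(UNIV, proj K V \<circ> T) \<in> linear_ops H K"
  by (auto simp: linear_ops_iff bounded_ops_add[OF T] bounded_ops_sc[OF T] K.proj_add[OF V_closed]
      K.proj_sc[OF V_closed])

lemma ip_compression: "v \<in> V \<Longrightarrow> ipr K (proj K V (T x)) v = ipr H x (adj H K T v)"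
  by (simp add: K.ip_proj[OF V_closed] K.proj_id[OF V_closed(1)] adj_ip[OF T])

text \<open>A difference \<open>adj H K T v\<close> has as its squared norm the pairing of its
  compression with \<open>v\<close>, so a zero compression forces it to vanish.\<close>

lemma inj_on_X: "inj_on (proj K V \<circ> T) X"
proof (rule inj_onI)
  fix x y assume xy: "x \<in> X" "y \<in> X" "(proj K V \<circ> T) x = (proj K V \<circ> T) y"
  then have "x - y \<in> X" using H.vs.subspace_diff[OF X_closed(1)] by blast
  then obtain v where v: "v \<in> V" "x - y = adj H K T v" by auto
  have "ipr H (x - y) (x - y) = ipr K (proj K V (T (x - y))) v"
    using ip_compression[OF v(1), of "x - y"] v(2) by simp
  also have "\<dots> = 0" using xy(3) by (simp add: proj_T)
  finally show "x = y" by simp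
qed

lemma outer_inv_eq:
  assumes "x \<in> X" "proj K V (T x) = proj K V y"
  shows "outer_inv H K T V y = x"
  unfolding outer_inv_def
  by (rule inv_into_f_eq[OF inj_on_X assms(1)]) (simp add: assms(2))

text \<open>A vector of \<open>V\<close> orthogonal to the image of \<open>X\<close> is killed by the adjoint, hence zero.\<close>

lemma compression_image: "(proj K V \<circ> T) ` X = V"
proof
  show "(proj K V \<circ> T) ` X \<subseteq> V" using K.proj_in[OF V_closed] by auto
  let ?Y = "(proj K V \<circ> T) ` X"
  obtain r where "dim_at_most H X r" using fin_X by (auto simp: fin_dim_subspace_def)
  then have "fin_dim_subspace K ?Y"
    using dim_at_most_image[OF compression_linear_ops] K.dim_at_most_fin_dim by blast
  then have Y: "K.sub ?Y" "closed ?Y"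
    using K.fin_dim_subspace_closed K.fin_dim_subspace_sub by auto
  show "V \<subseteq> ?Y"
  proof
    fix v assume v: "v \<in> V"
    define w where "w = v - proj K ?Y v"
    have wV: "w \<in> V" unfolding w_def
      using v K.proj_in[OF Y, of v] \<open>?Y \<subseteq> V\<close> K.vs.subspace_diff[OF V_closed(1)] by blast
    have "(proj K V \<circ> T) (adj H K T w) \<in> ?Y" using wV by blast
    then have "ipr K ((proj K V \<circ> T) (adj H K T w)) w = 0"
      using K.orthD'[OF K.proj_orth[OF Y, of v]] unfolding w_def by blast
    then have z: "adj H K T w = 0" by (simp add: ip_compression[OF wV])
    have "ipr K (T x) w = 0" for x by (simp add: adj_ip[OF T] z)
    then have "w \<in> orth K (range T)" by (auto simp: orth_def K.ip_eq_0_sym)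
    then have "w \<in> orth K (closure (range T))" by (simp add: K.orth_closure)
    then have "w = 0" using K.orth_Int wV V by blast
    then show "v \<in> ?Y" using K.proj_in[OF Y, of v] by (simp add: w_def)
  qed
qed

lemma outer_inv_props:
  "outer_inv H K T V y \<in> X" "proj K V (T (outer_inv H K T V y)) = proj K V y"
proof -
  have "proj K V y \<in> (proj K V \<circ> T) ` X"
    unfolding compression_image by (rule K.proj_in[OF V_closed])
  then obtain x where x: "x \<in> X" "proj K V (T x) = proj K V y" unfolding image_iff by force
  moreover from x have "outer_inv H K T V y = x" by (rule outer_inv_eq)
  ultimately show "outer_inv H K T V y \<in> X" "proj K V (T (outer_inv H K T V y)) = proj K V y"
    by simp_all
qed

text \<open>By the uniqueness in \<open>outer_inv_eq\<close>, linearity reduces to checking the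
  defining equation for the candidate value.\<close>

lemma outer_inv_linear_ops: "(UNIV, outer_inv H K T V) \<in> linear_ops K H"
proof -
  note * = H.vs.subspace_add[OF X_closed(1)] H.vs.subspace_scale[OF X_closed(1)] outer_inv_props
    bounded_ops_add[OF T] bounded_ops_sc[OF T] K.proj_add[OF V_closed] K.proj_sc[OF V_closed]
  have "outer_inv H K T V (x + y) = outer_inv H K T V x + outer_inv H K T V y" for x y
    by (rule outer_inv_eq) (simp_all add: * del: image_iff)
  moreover have "outer_inv H K T V (scl K c x) = scl H c (outer_inv H K T V x)" for c x
    by (rule outer_inv_eq) (simp_all add: * del: image_iff)
  ultimately show ?thesis by (simp add: linear_ops_def)
qed

text \<open>The outer inverse factors through \<open>proj K V\<close>, whose range is
  finite-dimensional.\<close>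

lemma outer_inv_bounded: "outer_inv H K T V \<in> bounded_ops K H"
proof -
  interpret swap: hilbert_pair K H by unfold_locales
  have "(V, outer_inv H K T V) \<in> linear_ops K H"
    using outer_inv_linear_ops V_closed by (simp add: linear_ops_def)
  moreover have "range (proj K V) \<subseteq> V" using K.proj_in[OF V_closed] by auto
  ultimately have "outer_inv H K T V \<circ> proj K V \<in> bounded_ops K H"
    using swap.finite_rank_compose_bounded[OF K.proj_bounded[OF V_closed] K.hilbert_space_axioms fin]
    by blast
  moreover have "outer_inv H K T V \<circ> proj K V = outer_inv H K T V"
    by (auto simp: outer_inv_def K.proj_id[OF V_closed(1) K.proj_in[OF V_closed]])
  ultimately show ?thesis by simp
qed

text \<open>The residual \<open>x - proj H X x\<close> is orthogonal to \<open>X\<close>, so its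
  image under \<open>T\<close> is orthogonal to \<open>V\<close> and disappears in the
  compression.\<close>

lemma outer_inv_apply: "outer_inv H K T V (T x) = proj H X x"
proof (rule outer_inv_eq)
  show "proj H X x \<in> X" by (rule H.proj_in[OF X_closed])
  have "T (x - proj H X x) \<in> orth K V"
    using H.proj_orth[OF X_closed, of x] by (auto simp: orth_def adj_ip[OF T])
  then have "proj K V (T (x - proj H X x)) = 0" by (rule K.proj_eq_0[OF V_closed(1)])
  then show "proj K V (T (proj H X x)) = proj K V (T x)" by (simp add: proj_T)
qed

lemma outer_inv_proj_range: "outer_inv H K T V (proj K (closure (range T)) y) = outer_inv H K T V y"
  unfolding outer_inv_def
  using K.proj_proj_subset[OF V_closed K.subspace_closure[OF subspace_range[OF T]] closed_closure V]
  by simp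

text \<open>The closure of the range contains \<open>V\<close>, so \<open>k\<close> is orthogonal to
  \<open>V\<close> as well. This evaluates the outer inverse on the domain of the Moore-Penrose
  inverse.\<close>

lemma outer_inv_add_orth:
  assumes "k \<in> orth K (range T)"
  shows "outer_inv H K T V (T x + k) = proj H X x"
proof -
  have "k \<in> orth K (closure (range T))" using assms by (simp add: K.orth_closure)
  then have "k \<in> orth K V" using V unfolding orth_def by blast
  then have "proj K V (T x + k) = proj K V (T x)"
    by (simp add: K.proj_add[OF V_closed] K.proj_eq_0[OF V_closed(1)])
  then show ?thesis using outer_inv_apply[of x] by (simp add: outer_inv_def)
qed

end

section \<open>Density of the adjoint images in the complement of the kernel\<close>

context hilbert_pair
begin

text \<open>If the residual \<open>u\<close> of \<open>x\<close> is orthogonal to all adjoint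
  images, then \<open>T u\<close> is orthogonal to every \<open>Y n\<close>, hence to the range, so
  \<open>u\<close> lies in the kernel. Then \<open>u\<close> is orthogonal both to \<open>x\<close>
  and to the projection of \<open>x\<close>, thus to itself.\<close>

lemma orth_ker_subset_closure_adj:
  assumes T: "T \<in> bounded_ops H K" and Y: "\<And>n::nat. fin_dim_subspace K (Y n)" "mono Y"
    and dense: "closure (\<Union>n. Y n) = closure (range T)"
  shows "orth H (ker T) \<subseteq> closure (\<Union>n. adj H K T ` Y n)"
proof
  interpret swap: hilbert_pair K H by unfold_locales
  fix x assume x: "x \<in> orth H (ker T)"
  let ?U = "\<Union>n. adj H K T ` Y n"
  have "H.sub ?U"
  proof (rule H.subspace_UN_mono)
    show "H.sub (adj H K T ` Y n)" for n
      by (rule swap.subspace_image[OF adj_linear_ops[OF T]]) (use K.fin_dim_subspace_sub Y in auto)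
    show "mono (\<lambda>n. adj H K T ` Y n)" using Y(2) by (auto intro!: monoI dest: monoD)
  qed
  then have U: "H.sub (closure ?U)" by (rule H.subspace_closure)
  define u where "u = x - proj H (closure ?U) x"
  have u: "u \<in> orth H ?U"
    using H.proj_orth[OF U closed_closure, of x] by (simp add: u_def H.orth_closure)
  have "ipr K (T u) y = 0" if "y \<in> Y n" for y n
    unfolding adj_ip[OF T] by (rule H.orthD[OF u]) (use that in blast)
  then have "T u \<in> orth K (\<Union>n. Y n)" by (auto simp: orth_def)
  then have "T u \<in> orth K (closure (\<Union>n. Y n))" by (simp add: K.orth_closure)
  then have "T u \<in> orth K (closure (range T))" by (simp only: dense)
  moreover have "T u \<in> closure (range T)" by (rule subsetD[OF closure_subset rangeI])
  ultimately have "T u = 0" using K.orth_Int by simp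
  then have "ipr H x u = 0" using H.orthD[OF x] by (simp add: ker_def)
  moreover have "ipr H (proj H (closure ?U) x) u = 0"
    unfolding u_def by (rule H.orthD'[OF H.proj_orth H.proj_in]) (use U in auto)
  ultimately have "ipr H u u = 0"
    using H.ip_diff_left[of x "proj H (closure ?U) x" u] by (simp add: u_def[symmetric])
  then have "x = proj H (closure ?U) x" by (simp add: u_def)
  then show "x \<in> closure ?U" using H.proj_in[OF U closed_closure, of x] by simp
qed

end

section \<open>The rank-constrained approximation problem\<close>

lemma bounded_rank_compose_left:
  assumes "hilbert_space H" "hilbert_space K" "hilbert_space L"
    and T: "T \<in> bounded_rank_ops H K r" and S: "S \<in> bounded_ops K L"
  shows "S \<circ> T \<in> bounded_rank_ops H L r"
proof -
  interpret hilbert_pair K L using assms by (simp add: hilbert_pair_def)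
  have T': "T \<in> bounded_ops H K" "dim_at_most K (range T) r"
    using T by (auto simp: bounded_rank_ops_def)
  have "dim_at_most L (S ` range T) r"
    by (rule dim_at_most_image[OF bounded_ops_linear_ops[OF S, of UNIV] T'(2)]) auto
  then show ?thesis
    using bounded_ops_compose[OF assms(1-3) T'(1) S] by (simp add: bounded_rank_ops_def image_comp)
qed

lemma bounded_rank_compose_right:
  assumes "hilbert_space H" "hilbert_space K" "hilbert_space L"
    and T: "T \<in> bounded_ops H K" and S: "S \<in> bounded_rank_ops K L r"
  shows "S \<circ> T \<in> bounded_rank_ops H L r"
proof -
  interpret hilbert_pair H L using assms by (simp add: hilbert_pair_def)
  have S': "S \<in> bounded_ops K L" "dim_at_most L (range S) r"
    using S by (auto simp: bounded_rank_ops_def)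
  have ST: "S \<circ> T \<in> bounded_ops H L" by (rule bounded_ops_compose[OF assms(1-3) T S'(1)])
  have "dim_at_most L (range (S \<circ> T)) r"
    by (rule K.dim_at_most_subset[OF subspace_range[OF ST] _ S'(2)]) auto
  with ST show ?thesis by (simp add: bounded_rank_ops_def)
qed

section \<open>Optimality of the Moore-Penrose candidate\<close>

locale rank_constrained =
  H1: hilbert_space H1 + H2: hilbert_space H2 + H3: hilbert_space H3 + H4: hilbert_space H4
  for H1 :: "('k::rc_field, 'a::{real_inner,complete_space}) hilb"
    and H2 :: "('k, 'b::{real_inner,complete_space}) hilb"
    and H3 :: "('k, 'c::{real_inner,complete_space}) hilb"
    and H4 :: "('k, 'd::{real_inner,complete_space}) hilb" +
  fixes M Kr :: "'a \<Rightarrow> 'd" and B :: "'c \<Rightarrow> 'd" and C :: "'a \<Rightarrow> 'b" and r :: nat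
  assumes M: "M \<in> hs_ops H1 H4" and B: "B \<in> bounded_ops H3 H4" and C: "C \<in> bounded_ops H1 H2"
    and Kr: "Kr \<in> Y_set H1 H4 B (proj H4 (closure (range B)) \<circ> M \<circ> proj H1 (orth H1 (ker C))) r"
begin

sublocale P12: hilbert_pair H1 H2 by unfold_locales
sublocale P14: hilbert_pair H1 H4 by unfold_locales
sublocale P21: hilbert_pair H2 H1 by unfold_locales
sublocale P34: hilbert_pair H3 H4 by unfold_locales
sublocale P43: hilbert_pair H4 H3 by unfold_locales
sublocale P23: hilbert_pair H2 H3 by unfold_locales
sublocale P13: hilbert_pair H1 H3 by unfold_locales
sublocale P44: hilbert_pair H4 H4 by unfold_locales

lemmas hilberts = H1.hilbert_space_axioms H2.hilbert_space_axioms H3.hilbert_space_axioms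
  H4.hilbert_space_axioms

definition "P = proj H4 (closure (range B))"
definition "Q = proj H1 (orth H1 (ker C))"
definition "K x = P (M (Q x))"
text \<open>The common left factor of \<open>Xhat\<close> and all \<open>Xhatn n\<close>; finite
  rank of \<open>Kr\<close> makes it bounded although the Moore-Penrose inverse of \<open>B\<close>
  need not be.\<close>

definition "A = pinv H3 H4 B \<circ> Kr"

lemma closure_range_B: "H4.sub (closure (range B))"
  by (rule H4.subspace_closure[OF P34.subspace_range[OF B]])

lemma P_diff: "P (x - y) = P x - P y"
  unfolding P_def
  by (rule P44.bounded_ops_diff_arg[OF H4.proj_bounded[OF closure_range_B closed_closure]])

lemma P_idem: "P (P x) = P x"
  unfolding P_def by (intro H4.proj_id closure_range_B H4.proj_in) simp

lemma P_B: "P (B x) = B x"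
  unfolding P_def by (rule H4.proj_id[OF closure_range_B subsetD[OF closure_subset rangeI]])

lemma Q_idem: "Q (Q x) = Q x"
  unfolding Q_def by (intro H1.proj_id H1.subspace_orth H1.proj_in H1.closed_orth)

lemma C_Q: "C (Q x) = C x"
  unfolding Q_def by (rule P12.ker_orth_decomposition[OF C])

lemma hs_P: "T \<in> hs_ops H1 H4 \<Longrightarrow> (\<lambda>x. P (T x)) \<in> hs_ops H1 H4"
  "T \<in> hs_ops H1 H4 \<Longrightarrow> (hs_norm H1 T)\<^sup>2
    = (hs_norm H1 (\<lambda>x. P (T x)))\<^sup>2 + (hs_norm H1 (\<lambda>x. T x - P (T x)))\<^sup>2"
  "T \<in> hs_ops H1 H4 \<Longrightarrow> (\<lambda>x. T x - P (T x)) \<in> hs_ops H1 H4"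
  unfolding P_def by (rule P14.hs_proj_left[OF _ closure_range_B closed_closure]; assumption)+

lemma hs_Q: "T \<in> hs_ops H1 H4 \<Longrightarrow> (\<lambda>x. T (Q x)) \<in> hs_ops H1 H4"
  "T \<in> hs_ops H1 H4 \<Longrightarrow> (hs_norm H1 T)\<^sup>2
    = (hs_norm H1 (\<lambda>x. T (Q x)))\<^sup>2 + (hs_norm H1 (\<lambda>x. T x - T (Q x)))\<^sup>2"
  "T \<in> hs_ops H1 H4 \<Longrightarrow> (\<lambda>x. T x - T (Q x)) \<in> hs_ops H1 H4"
  unfolding Q_def by (rule P14.hs_proj_right[OF _ H1.subspace_orth H1.closed_orth]; assumption)+

lemma hs_K: "K \<in> hs_ops H1 H4"
  unfolding K_def[abs_def] by (intro hs_P hs_Q M)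

lemma Kr_props:
  "Kr \<in> bounded_rank_ops H1 H4 r" "range Kr \<subseteq> pinv_dom H4 B"
  and Kr_optimal: "Y \<in> bounded_rank_ops H1 H4 r
    \<Longrightarrow> hs_norm H1 (\<lambda>x. K x - Kr x) \<le> hs_norm H1 (\<lambda>x. K x - Y x)"
  using Kr unfolding Y_set_def by (auto simp: P_def Q_def K_def)

lemma Kr_bounded: "Kr \<in> bounded_ops H1 H4" and Kr_hs: "Kr \<in> hs_ops H1 H4"
  and Kr_rank: "dim_at_most H4 (range Kr) r"
  using Kr_props(1) P14.bounded_rank_hs by (auto simp: bounded_rank_ops_def)

text \<open>Projecting a best approximation on either side cannot increase its rank or its distance to
  \<open>K\<close>; by Pythagoras the part that the projection removes must vanish.\<close>

lemma P_Kr: "P (Kr x) = Kr x"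
proof -
  let ?D = "\<lambda>x. K x - Kr x"
  have D: "?D \<in> hs_ops H1 H4" by (rule P14.hs_diff(1)[OF hs_K Kr_hs])
  have "(\<lambda>x. P (Kr x)) \<in> bounded_rank_ops H1 H4 r"
    using bounded_rank_compose_left[OF hilberts(1,4,4) Kr_props(1)
      H4.proj_bounded[OF closure_range_B closed_closure]] by (simp add: o_def P_def)
  then have "hs_norm H1 ?D \<le> hs_norm H1 (\<lambda>x. K x - P (Kr x))" by (rule Kr_optimal)
  \<comment> \<open>\<open>P\<close> fixes the values of \<open>K\<close>, so projecting the
    competitor amounts to projecting the whole difference.\<close>
  also have "(\<lambda>x. K x - P (Kr x)) = (\<lambda>x. P (?D x))" by (simp add: P_diff K_def P_idem)
  finally have "(hs_norm H1 ?D)\<^sup>2 \<le> (hs_norm H1 (\<lambda>x. P (?D x)))\<^sup>2"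
    by (rule power_mono[OF _ hs_norm_nonneg])
  with hs_P(2)[OF D] have "hs_norm H1 (\<lambda>x. ?D x - P (?D x)) = 0" by simp
  from P14.hs_norm_eq_0[OF hs_P(3)[OF D] this, of x] show ?thesis
    by (simp add: P_diff K_def P_idem)
qed

lemma Kr_Q: "Kr (Q x) = Kr x"
proof -
  let ?D = "\<lambda>x. K x - Kr x"
  have D: "?D \<in> hs_ops H1 H4" by (rule P14.hs_diff(1)[OF hs_K Kr_hs])
  have "(\<lambda>x. Kr (Q x)) \<in> bounded_rank_ops H1 H4 r"
    using bounded_rank_compose_right[OF hilberts(1,1,4)
      H1.proj_bounded[OF H1.subspace_orth H1.closed_orth] Kr_props(1)] by (simp add: o_def Q_def)
  then have "hs_norm H1 ?D \<le> hs_norm H1 (\<lambda>x. K x - Kr (Q x))" by (rule Kr_optimal)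
  also have "(\<lambda>x. K x - Kr (Q x)) = (\<lambda>x. ?D (Q x))" by (simp add: K_def Q_idem)
  finally have "(hs_norm H1 ?D)\<^sup>2 \<le> (hs_norm H1 (\<lambda>x. ?D (Q x)))\<^sup>2"
    by (rule power_mono[OF _ hs_norm_nonneg])
  with hs_Q(2)[OF D] have "hs_norm H1 (\<lambda>x. ?D x - ?D (Q x)) = 0" by simp
  from P14.hs_norm_eq_0[OF hs_Q(3)[OF D] this, of x] show ?thesis
    by (simp add: K_def Q_idem)
qed

text \<open>Splitting \<open>M - Z\<close> by \<open>P\<close> on the left separates
  \<open>M - P M\<close>; splitting the rest \<open>P M - Z\<close> by \<open>Q\<close> on the right
  separates \<open>P M - K\<close> and leaves \<open>K - Z\<close>.\<close>

lemma hs_norm_split: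
  assumes Z: "Z \<in> hs_ops H1 H4" and PZ: "\<And>x. P (Z x) = Z x" and ZQ: "\<And>x. Z (Q x) = Z x"
  shows "(hs_norm H1 (\<lambda>x. M x - Z x))\<^sup>2 = (hs_norm H1 (\<lambda>x. K x - Z x))\<^sup>2
    + (hs_norm H1 (\<lambda>x. P (M x) - K x))\<^sup>2 + (hs_norm H1 (\<lambda>x. M x - P (M x)))\<^sup>2"
proof -
  let ?D = "\<lambda>x. M x - Z x"
  have D: "?D \<in> hs_ops H1 H4" by (rule P14.hs_diff(1)[OF M Z])
  show ?thesis
    using hs_P(2)[OF D] hs_Q(2)[OF hs_P(1)[OF D]] by (simp add: P_diff PZ ZQ K_def)
qed

text \<open>The product of \<open>B\<close>, \<open>X\<close> and \<open>C\<close> competes with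
  \<open>Kr\<close> in the approximation of \<open>K\<close>, and \<open>hs_norm_split\<close> adds
  the same two terms on both sides when \<open>K\<close> is replaced by \<open>M\<close>.\<close>

lemma Kr_best:
  assumes X: "(D, X) \<in> X_set H1 H2 H3 H4 B C r"
  shows "hs_norm H1 (\<lambda>x. M x - Kr x) \<le> hs_norm H1 (\<lambda>x. M x - B (X (C x)))"
proof -
  let ?Z = "\<lambda>x. B (X (C x))"
  have X': "(D, X) \<in> linear_ops H2 H3" "pinv_dom H2 C \<subseteq> D" "dim_at_most H3 (X ` D) r"
    and Z: "?Z \<in> hs_ops H1 H4"
    using X by (auto simp: X_set_def o_def)
  have "dim_at_most H4 (B ` X ` D) r"
    by (rule P34.dim_at_most_image[OF P34.bounded_ops_linear_ops[OF B, of UNIV] X'(3)]) auto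
  \<comment> \<open>The values of \<open>C\<close> lie in \<open>pinv_dom H2 C\<close> and so in
    \<open>D\<close>, where \<open>X\<close> has its meaning.\<close>
  moreover have "range ?Z \<subseteq> B ` X ` D" using P12.range_subset_pinv_dom X'(2) by fastforce
  ultimately have "dim_at_most H4 (range ?Z) r"
    using H4.dim_at_most_subset[OF P14.subspace_range[OF hs_ops_bounded[OF Z]]] by blast
  then have "?Z \<in> bounded_rank_ops H1 H4 r"
    using hs_ops_bounded[OF Z] by (simp add: bounded_rank_ops_def)
  then have "(hs_norm H1 (\<lambda>x. K x - Kr x))\<^sup>2 \<le> (hs_norm H1 (\<lambda>x. K x - ?Z x))\<^sup>2"
    by (rule power_mono[OF Kr_optimal hs_norm_nonneg])
  then have "(hs_norm H1 (\<lambda>x. M x - Kr x))\<^sup>2 \<le> (hs_norm H1 (\<lambda>x. M x - ?Z x))\<^sup>2"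
    unfolding hs_norm_split[OF Kr_hs P_Kr Kr_Q] hs_norm_split[of ?Z, OF Z P_B arg_cong[OF C_Q]]
    by simp
  then show ?thesis by (rule power2_le_imp_le[OF _ hs_norm_nonneg])
qed

lemma pinv_B_linear_ops: "(range Kr, pinv H3 H4 B) \<in> linear_ops H4 H3"
  using P34.pinv_linear_ops[OF B] Kr_props(2) P14.subspace_range[OF Kr_bounded]
  unfolding P43.linear_ops_iff by blast

lemma A_bounded_rank: "A \<in> bounded_rank_ops H1 H3 r"
proof -
  have "A \<in> bounded_ops H1 H3"
    unfolding A_def
    by (rule P43.finite_rank_compose_bounded[OF Kr_bounded H1.hilbert_space_axioms
      H4.dim_at_most_fin_dim[OF Kr_rank] order_refl pinv_B_linear_ops])
  moreover have "dim_at_most H3 (pinv H3 H4 B ` range Kr) r"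
    by (rule P43.dim_at_most_image[OF pinv_B_linear_ops Kr_rank order_refl])
  ultimately show ?thesis by (simp add: bounded_rank_ops_def A_def image_comp)
qed

lemma A_bounded: "A \<in> bounded_ops H1 H3"
  using A_bounded_rank by (simp add: bounded_rank_ops_def)

text \<open>\<open>P_Kr\<close> places the values of \<open>Kr\<close> in the closure of the range
  of \<open>B\<close>, where the Moore-Penrose inverse is a right inverse on its domain.\<close>

lemma B_A: "B (A x) = Kr x"
proof -
  have "Kr x \<in> closure (range B)"
    using H4.proj_in[OF closure_range_B closed_closure, of "Kr x"] P_Kr[of x] by (simp add: P_def)
  then show ?thesis
    using P34.apply_pinv[OF B] Kr_props(2) by (auto simp: A_def)
qed

text \<open>Every bounded competitor is admissible with full domain, so the infimum cannot fall
  below the minimum.\<close>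

lemma bounded_rank_X_set:
  assumes "X \<in> bounded_rank_ops H2 H3 r"
  shows "(UNIV, X) \<in> X_set H1 H2 H3 H4 B C r"
proof -
  have X: "X \<in> bounded_ops H2 H3" "dim_at_most H3 (range X) r"
    using assms by (auto simp: bounded_rank_ops_def)
  have "B \<circ> X \<in> bounded_rank_ops H2 H4 r"
    by (rule bounded_rank_compose_left[OF hilberts(2-4) assms B])
  then have "B \<circ> X \<circ> C \<in> bounded_rank_ops H1 H4 r"
    by (rule bounded_rank_compose_right[OF hilberts(1,2,4) C])
  then show ?thesis
    using X P14.bounded_rank_hs P23.bounded_ops_linear_ops[OF X(1), of UNIV] by (simp add: X_set_def)
qed

definition "Xhat = A \<circ> pinv H1 H2 C"

text \<open>\<open>pinv H1 H2 C\<close> after \<open>C\<close> is \<open>Q\<close>, and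
  \<open>Kr\<close> absorbs \<open>Q\<close> on the right.\<close>

lemma B_Xhat_C: "B (Xhat (C x)) = Kr x"
proof -
  have "Xhat (C x) = A (Q x)" by (simp add: Xhat_def Q_def P12.pinv_apply[OF C])
  then show ?thesis by (simp add: B_A Kr_Q)
qed

text \<open>The rank bound is inherited from \<open>A\<close>, and \<open>B_Xhat_C\<close> reduces
  the Hilbert-Schmidt condition to that for \<open>Kr\<close>.\<close>

lemma Xhat_in_X_set: "(pinv_dom H2 C, Xhat) \<in> X_set H1 H2 H3 H4 B C r"
proof -
  note pl = P12.pinv_linear_ops[OF C, unfolded P21.linear_ops_iff]
  have lin: "(pinv_dom H2 C, Xhat) \<in> linear_ops H2 H3"
    using pl unfolding P23.linear_ops_iff
    by (auto simp: Xhat_def P13.bounded_ops_add[OF A_bounded] P13.bounded_ops_sc[OF A_bounded])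
  have "dim_at_most H3 (Xhat ` pinv_dom H2 C) r"
  proof (rule H3.dim_at_most_subset)
    show "H3.sub (Xhat ` pinv_dom H2 C)" by (rule P23.subspace_image[OF lin]) (use pl in auto)
    show "dim_at_most H3 (range A) r" using A_bounded_rank by (simp add: bounded_rank_ops_def)
  qed (auto simp: Xhat_def)
  moreover have "B \<circ> Xhat \<circ> C = Kr" by (auto simp: B_Xhat_C)
  ultimately show ?thesis using lin Kr_hs by (simp add: X_set_def)
qed

end

section \<open>Convergence of the finite-rank approximations\<close>

locale rank_constrained_outer = rank_constrained H1 H2 H3 H4 M Kr B C r
  for H1 :: "('k::rc_field, 'a::{real_inner,complete_space}) hilb"
    and H2 :: "('k, 'b::{real_inner,complete_space}) hilb"
    and H3 :: "('k, 'c::{real_inner,complete_space}) hilb"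
    and H4 :: "('k, 'd::{real_inner,complete_space}) hilb"
    and M Kr :: "'a \<Rightarrow> 'd" and B :: "'c \<Rightarrow> 'd" and C :: "'a \<Rightarrow> 'b" and r :: nat +
  fixes Yn :: "nat \<Rightarrow> 'b set"
  assumes Yn: "\<And>n. fin_dim_subspace H2 (Yn n)" "mono Yn" "\<And>n. Yn n \<subseteq> closure (range C)"
    "closure (\<Union>n. Yn n) = closure (range C)"
begin

sublocale O: outer_inverse H1 H2 C "Yn n" for n
  by unfold_locales (use C Yn in auto)

definition "Xn n = adj H1 H2 C ` Yn n"
definition "Xhatn n = A \<circ> outer_inv H1 H2 C (Yn n)"

lemma Xn_closed: "H1.sub (Xn n)" "closed (Xn n)"
  using O.X_closed[of n] by (auto simp: Xn_def)

lemma proj_Xn_tendsto: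
  assumes "x \<in> orth H1 (ker C)"
  shows "(\<lambda>n. proj H1 (Xn n) x) \<longlonglongrightarrow> x"
proof (rule H1.proj_tendsto[OF Xn_closed])
  show "mono Xn" unfolding Xn_def by (intro monoI image_mono monoD[OF Yn(2)])
  show "x \<in> closure (\<Union>n. Xn n)"
    using P12.orth_ker_subset_closure_adj[OF C Yn(1,2,4)] assms by (auto simp: Xn_def)
qed

lemma Xhatn_bounded_rank: "Xhatn n \<in> bounded_rank_ops H2 H3 r"
  unfolding Xhatn_def by (rule bounded_rank_compose_right[OF hilberts(2,1,3) O.outer_inv_bounded A_bounded_rank])

text \<open>On \<open>C x + k\<close> the two inverses return \<open>proj H1 (Xn n) x\<close> and
  \<open>x\<close>, and \<open>A\<close> is continuous.\<close>

lemma Xhatn_tendsto: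
  assumes "y \<in> pinv_dom H2 C"
  shows "(\<lambda>n. Xhatn n y) \<longlonglongrightarrow> Xhat y"
proof -
  obtain x k where x: "x \<in> orth H1 (ker C)" "k \<in> orth H2 (range C)" "y = C x + k"
    using assms by (rule P12.pinv_domE[OF C])
  have "(\<lambda>n. A (proj H1 (Xn n) x)) \<longlonglongrightarrow> A x"
    by (rule bounded_linear.tendsto[OF bounded_ops_bounded_linear[OF A_bounded] proj_Xn_tendsto[OF x(1)]])
  then show ?thesis
    by (simp add: Xhatn_def Xhat_def x(3) P12.pinv_eq[OF C x(1,2)] O.outer_inv_add_orth[OF x(2)] Xn_def)
qed

lemma B_Xhatn_C: "B (Xhatn n (C x)) = Kr (proj H1 (Xn n) x)"
  by (simp add: Xhatn_def O.outer_inv_apply B_A Xn_def)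

text \<open>Values of the Moore-Penrose inverse of \<open>B\<close> are orthogonal to its kernel,
  and the outer inverse sees a vector only through its projection onto \<open>Yn n\<close>, a
  subspace of the closure of the range of \<open>C\<close>.\<close>

lemma Xhatn_proj: "proj H3 (orth H3 (ker B)) \<circ> Xhatn n \<circ> proj H2 (closure (range C)) = Xhatn n"
proof
  fix y
  have "A x \<in> orth H3 (ker B)" for x
    unfolding A_def comp_apply by (rule P34.pinv_in_orth_ker[OF B]) (use Kr_props(2) in blast)
  then show "(proj H3 (orth H3 (ker B)) \<circ> Xhatn n \<circ> proj H2 (closure (range C))) y = Xhatn n y"
    by (simp add: Xhatn_def O.outer_inv_proj_range H3.proj_id[OF H3.subspace_orth])
qed

text \<open>Since \<open>Kr\<close> absorbs \<open>Q\<close>, it vanishes on the kernel of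
  \<open>C\<close>. This puts the values of its adjoint where the projectors onto
  \<open>Xn n\<close> converge to the identity.\<close>

lemma adj_Kr_orth_ker: "adj H1 H4 Kr y \<in> orth H1 (ker C)"
proof -
  have "ipr H1 u (adj H1 H4 Kr y) = 0" if u: "u \<in> ker C" for u
  proof -
    have "u \<in> orth H1 (orth H1 (ker C))" using u H1.orth_orth_subset by blast
    then have "Q u = 0" unfolding Q_def by (rule H1.proj_eq_0[OF H1.subspace_orth])
    then have "Kr u = 0" using Kr_Q[of u] P14.bounded_ops_zero[OF Kr_bounded] by simp
    then show ?thesis by (simp add: P14.adj_ip[OF Kr_bounded, symmetric])
  qed
  then show ?thesis by (auto simp: orth_def H1.ip_eq_0_sym)
qed

lemma hs_norm_tendsto: "(\<lambda>n. hs_norm H1 (\<lambda>x. Kr (proj H1 (Xn n) x) - Kr x)) \<longlonglongrightarrow> 0"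
proof -
  let ?S = "adj H1 H4 Kr"
  obtain F where F: "finite F" "H4.orthonormal F" "range Kr = H4.vs.span F"
    by (rule H4.fin_dim_subspaceE[OF H4.dim_at_most_fin_dim[OF Kr_rank]])
  let ?D = "\<lambda>n x. Kr (proj H1 (Xn n) x) - Kr x"
  have "(hs_norm H1 (?D n))\<^sup>2 = (\<Sum>f\<in>F. (norm (proj H1 (Xn n) (?S f) - ?S f))\<^sup>2)" for n
  proof (rule P14.hs_finite_rank(2)[OF _ F(1,2)])
    have "Kr \<circ> proj H1 (Xn n) \<in> bounded_ops H1 H4"
      by (rule bounded_ops_compose[OF hilberts(1,1,4) H1.proj_bounded[OF Xn_closed] Kr_bounded])
    then show "?D n \<in> bounded_ops H1 H4"
      using bounded_ops_diff[OF hilberts(1,4) _ Kr_bounded] by (simp add: o_def)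
    show "range (?D n) \<subseteq> H4.vs.span F"
      using F(3) by (auto intro!: H4.vs.span_diff)
    show "ipr H4 (?D n x) y = ipr H1 x (proj H1 (Xn n) (?S y) - ?S y)" for x y
      by (simp add: H4.ip_diff_left H1.ip_diff_right P14.adj_ip[OF Kr_bounded] H1.ip_proj[OF Xn_closed])
  qed
  \<comment> \<open>Finiteness of \<open>F\<close> turns the pointwise convergence of the projectors
    into convergence in norm.\<close>
  moreover have "(\<lambda>n. \<Sum>f\<in>F. (norm (proj H1 (Xn n) (?S f) - ?S f))\<^sup>2) \<longlonglongrightarrow> (\<Sum>f\<in>F. (norm (?S f - ?S f))\<^sup>2)"
    by (intro tendsto_intros proj_Xn_tendsto adj_Kr_orth_ker)
  ultimately have "(\<lambda>n. (hs_norm H1 (?D n))\<^sup>2) \<longlonglongrightarrow> 0" by simp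
  then have "(\<lambda>n. sqrt ((hs_norm H1 (?D n))\<^sup>2)) \<longlonglongrightarrow> sqrt 0" by (rule tendsto_real_sqrt)
  then show ?thesis by (simp add: hs_norm_nonneg)
qed

text \<open>\<open>Kr_best\<close> gives the lower bound, and the values at \<open>Xhatn n\<close>
  come arbitrarily close to it.\<close>

lemma Inf_eq:
  "Inf {hs_norm H1 (\<lambda>x. M x - B (X (C x))) | X. X \<in> bounded_rank_ops H2 H3 r}
    = hs_norm H1 (\<lambda>x. M x - Kr x)" (is "Inf ?S = ?m")
proof (rule antisym)
  have lower: "?m \<le> v" if "v \<in> ?S" for v
    using that Kr_best[OF bounded_rank_X_set] by blast
  have mem: "hs_norm H1 (\<lambda>x. M x - B (Xhatn n (C x))) \<in> ?S" for n
    using Xhatn_bounded_rank by blast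
  then show "?m \<le> Inf ?S" by (intro cInf_greatest lower) blast+
  let ?D = "\<lambda>n x. Kr (proj H1 (Xn n) x) - Kr x"
  \<comment> \<open>Composed with \<open>B\<close> and \<open>C\<close>, \<open>Xhatn n\<close> is
    \<open>Kr\<close> plus \<open>?D n\<close>, so the triangle inequality separates the error that
    tends to 0.\<close>
  have "Inf ?S \<le> ?m + hs_norm H1 (?D n)" for n
  proof -
    have "Inf ?S \<le> hs_norm H1 (\<lambda>x. M x - B (Xhatn n (C x)))"
      by (rule cInf_lower[OF mem bdd_belowI[OF lower]])
    also have "(\<lambda>x. M x - B (Xhatn n (C x))) = (\<lambda>x. (M x - Kr x) - ?D n x)"
      by (simp add: B_Xhatn_C)
    also have "hs_norm H1 \<dots> \<le> ?m + hs_norm H1 (?D n)"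
      by (intro P14.hs_diff M Kr_hs P14.hs_proj_right(1)[OF Kr_hs Xn_closed])
    finally show ?thesis .
  qed
  then have "Inf ?S \<le> ?m + 0"
    by (intro LIMSEQ_le_const[OF tendsto_add[OF tendsto_const hs_norm_tendsto]]) blast
  then show "Inf ?S \<le> ?m" by simp
qed

end

theorem proposition5p5:
  fixes H1 :: "('k::rc_field, 'a::{real_inner,complete_space}) hilb"
    and H2 :: "('k, 'b::{real_inner,complete_space}) hilb"
    and H3 :: "('k, 'c::{real_inner,complete_space}) hilb"
    and H4 :: "('k, 'd::{real_inner,complete_space}) hilb"
    and r :: nat
    and M K Kr :: "'a \<Rightarrow> 'd" and B :: "'c \<Rightarrow> 'd" and C :: "'a \<Rightarrow> 'b"
    and Yn :: "nat \<Rightarrow> 'b set"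
    and Xhat :: "'b \<Rightarrow> 'c" and Xhatn :: "nat \<Rightarrow> 'b \<Rightarrow> 'c"
  assumes "hilbert_space H1" "hilbert_space H2" "hilbert_space H3" "hilbert_space H4"
    and "separable_space (euclidean :: 'a topology)" "separable_space (euclidean :: 'b topology)"
      "separable_space (euclidean :: 'c topology)" "separable_space (euclidean :: 'd topology)"
    and "M \<in> hs_ops H1 H4" and "B \<in> bounded_ops H3 H4" and "C \<in> bounded_ops H1 H2"
    and "K = proj H4 (closure (range B)) \<circ> M \<circ> proj H1 (orth H1 (ker C))"
    and "Kr \<in> Y_set H1 H4 B K r"
    and "Xhat = pinv H3 H4 B \<circ> Kr \<circ> pinv H1 H2 C"
    and "\<And>n. fin_dim_subspace H2 (Yn n)" and "mono Yn"
    and "\<And>n. Yn n \<subseteq> closure (range C)" and "closure (\<Union>n. Yn n) = closure (range C)"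
    and "\<And>n. Xhatn n = pinv H3 H4 B \<circ> Kr \<circ> outer_inv H1 H2 C (Yn n)"
  shows "(\<forall>n. Xhatn n \<in> bounded_rank_ops H2 H3 r)
    \<and> (\<forall>y \<in> pinv_dom H2 C. (\<lambda>n. Xhatn n y) \<longlonglongrightarrow> Xhat y)
    \<and> (\<forall>n. B \<circ> Xhatn n \<circ> C \<in> hs_ops H1 H4) \<and> B \<circ> Xhat \<circ> C \<in> hs_ops H1 H4
    \<and> (\<lambda>n. hs_norm H1 (\<lambda>x. B (Xhatn n (C x)) - B (Xhat (C x)))) \<longlonglongrightarrow> 0
    \<and> (\<forall>n. proj H3 (orth H3 (ker B)) \<circ> Xhatn n \<circ> proj H2 (closure (range C)) = Xhatn n)
    \<and> (\<exists>m. m = Inf {hs_norm H1 (\<lambda>x. M x - B (X (C x))) | X. X \<in> bounded_rank_ops H2 H3 r}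
        \<and> m \<in> {hs_norm H1 (\<lambda>x. M x - B (X (C x))) | D X. (D, X) \<in> X_set H1 H2 H3 H4 B C r}
        \<and> (\<forall>v \<in> {hs_norm H1 (\<lambda>x. M x - B (X (C x))) | D X. (D, X) \<in> X_set H1 H2 H3 H4 B C r}. m \<le> v))"
proof -
  interpret rank_constrained_outer H1 H2 H3 H4 M Kr B C r Yn
    using assms
    by (auto simp: rank_constrained_outer_def rank_constrained_def rank_constrained_axioms_def
        rank_constrained_outer_axioms_def)
  have X: "Xhat = local.Xhat" by (simp add: assms(14) Xhat_def A_def)
  have Xn: "Xhatn = local.Xhatn" by (rule ext) (simp add: assms(19) Xhatn_def A_def)
  let ?f = "\<lambda>X. hs_norm H1 (\<lambda>x. M x - B (X (C x)))"
  have m: "?f Xhat = Inf {?f X | X. X \<in> bounded_rank_ops H2 H3 r}"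
    by (simp add: Inf_eq X B_Xhat_C)
  have lower: "?f Xhat \<le> ?f Y" if "(D, Y) \<in> X_set H1 H2 H3 H4 B C r" for D Y
    using Kr_best[OF that] by (simp add: X B_Xhat_C)
  have hs: "B \<circ> Xhatn n \<circ> C \<in> hs_ops H1 H4" for n
    using bounded_rank_X_set[OF Xhatn_bounded_rank] by (simp add: X_set_def Xn)
  have "\<exists>m. m = Inf {?f X | X. X \<in> bounded_rank_ops H2 H3 r}
        \<and> m \<in> {?f X | D X. (D, X) \<in> X_set H1 H2 H3 H4 B C r}
        \<and> (\<forall>v \<in> {?f X | D X. (D, X) \<in> X_set H1 H2 H3 H4 B C r}. m \<le> v)"
  \<comment> \<open>The minimum is attained at \<open>Xhat\<close>, whose value is the distance from
    \<open>M\<close> to \<open>Kr\<close> by \<open>B_Xhat_C\<close>.\<close>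
  proof (intro exI[of _ "?f Xhat"] conjI m ballI)
    show "?f Xhat \<in> {?f X | D X. (D, X) \<in> X_set H1 H2 H3 H4 B C r}"
      using Xhat_in_X_set unfolding X by blast
    show "?f Xhat \<le> v" if "v \<in> {?f X | D X. (D, X) \<in> X_set H1 H2 H3 H4 B C r}" for v
      using that lower by blast
  qed
  moreover have "B \<circ> Xhat \<circ> C \<in> hs_ops H1 H4"
    using Xhat_in_X_set by (simp add: X_set_def X)
  moreover have "(\<lambda>n. hs_norm H1 (\<lambda>x. B (Xhatn n (C x)) - B (Xhat (C x)))) \<longlonglongrightarrow> 0"
    using hs_norm_tendsto by (simp add: X Xn B_Xhat_C B_Xhatn_C)
  ultimately show ?thesis
    using Xhatn_bounded_rank Xhatn_tendsto Xhatn_proj hs unfolding X Xn by blast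
qed

end
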